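(* Let $\xi$ be a central configuration of the planar $N$-vortex problem with $\nabla H(\xi)+\omega M_\Gamma\xi=0$, $\omega\in\mathbb{R}\setminus\{0\}$, let $z$ be the relative equilibrium generated by $\xi$, and let $\widehat A(\xi)=D^2H(\xi)+\omega M_\Gamma$. Assume that $z$ is non-degenerate and spectrally stable. Then: (i) If $\omega>0$, then $\mathrm{n}_-(\widehat A(\xi))=\mathrm{n}_-(M_\Gamma)$ if $\langle M_\Gamma\xi,\xi\rangle>0$, and $\mathrm{n}_-(\widehat A(\xi))=\mathrm{n}_-(M_\Gamma)-1$ if $\langle M_\Gamma\xi,\xi\rangle<0$. (ii) If $\omega<0$, then $\mathrm{n}_-(\widehat A(\xi))=\mathrm{n}_+(M_\Gamma)-1$ if $\langle M_\Gamma\xi,\xi\rangle>0$, and $\mathrm{n}_-(\widehat A(\xi))=\mathrm{n}_+(M_\Gamma)$ if $\langle M_\Gamma\xi,\xi\rangle<0$. Furthermore, with $W=\mathrm{span}(\xi,K\xi)$ and $W^\perp=\{w\in\mathbb{R}^{2N}: w^{\mathsf T}M_\Gamma v=0\ \ \forall v\in W\}$ the $M_\Gamma$-orthogonal complement of $W$, one has $$\mathrm{n}_-(\widehat A(\xi)|_{W^\perp})=\mathrm{n}_-(M_\Gamma|_{W^\perp})\ \text{ if }\omega>0,\qquad \mathrm{n}_-(\widehat A(\xi)|_{W^\perp})=\mathrm{n}_+(M_\Gamma|_{W^\perp})\ \text{ if }\omega<0.$$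
   Context: Let $N\ge 2$ and let $\Gamma_1,\dots,\Gamma_N\in\mathbb{R}\setminus\{0\}$ be circulations (of arbitrary signs) with nonzero total circulation $\sum_i\Gamma_i\neq 0$. Let $J=\begin{bmatrix}0&1\\-1&0\end{bmatrix}$, $K=I_N\otimes J$ (the $2N\times 2N$ block diagonal matrix with $N$ diagonal blocks $J$), and $M_\Gamma=\mathrm{diag}(\Gamma_1,\dots,\Gamma_N)\otimes I_2$. Put $\mathbb{F}_N(\mathbb{R}^2)=\{z=(z_1,\dots,z_N)\in(\mathbb{R}^2)^N: z_i\ne z_j \text{ for } i\neq j\}$ and $H(z)=-\sum_{i<j}\Gamma_i\Gamma_j\log|z_i-z_j|$ on it. A central configuration is $\xi\in\mathbb{F}_N(\mathbb{R}^2)$ such that $\nabla H(\xi)+\omega M_\Gamma\xi=0$ for some $\omega\in\mathbb{R}$. If $\omega\neq0$, $z(t)=e^{-\omega Kt}\xi$ is a periodic solution of $M_\Gamma\dot z=K\nabla H(z)$, called the relative equilibrium generated by $\xi$, with angular velocity $\omega$. $D^2H(\xi)$ denotes the Hessian of $H$ at $\xi$, and $\langle\cdot,\cdot\rangle$ the Euclidean product. The stability matrix is $B=K\,[M_\Gamma^{-1}D^2H(\xi)+\omega I_{2N}]$. By the symmetries of the problem, $B$ always has the eigenvalue $0$ (with algebraic multiplicity at least $2$) and the eigenvalues $\pm i\omega$; removing $0,0,i\omega,-i\omega$ from the list of the $2N$ eigenvalues of $B$ (counted with algebraic multiplicity) leaves the $2N-4$ nontrivial eigenvalues of $B$. The relative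 equilibrium is non-degenerate if all nontrivial eigenvalues of $B$ are nonzero. A non-degenerate relative equilibrium is spectrally stable if all nontrivial eigenvalues of $B$ are purely imaginary. For a symmetric matrix $S$, $\mathrm{n}_-(S)$ (Morse index) and $\mathrm{n}_+(S)$ (Morse coindex) are the numbers of negative and positive eigenvalues, counted with multiplicity; for a subspace $X$, $\mathrm{n}_\pm(S|_X)$ is the index/coindex of the quadratic form $\langle S\cdot,\cdot\rangle$ restricted to $X$. *)

theory Defs
  imports "HOL-Analysis.Analysis" "HOL-Computational_Algebra.Polynomial"
begin

section \<open>Matrices\<close>

definition kron :: "'a::times^'n^'m \<Rightarrow> 'a^'q^'p \<Rightarrow> 'a^('n \<times> 'q)^('m \<times> 'p)" where
  "kron A B = (\<chi> r c. A $ fst r $ fst c * B $ snd r $ snd c)"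

definition matrix_exp :: "real^'n^'n \<Rightarrow> real^'n^'n" where
  "matrix_exp A = (\<Sum>k. (((**) A ^^ k) (mat 1)) /\<^sub>R fact k)"

definition charpoly :: "'a::comm_ring_1^'n^'n \<Rightarrow> 'a poly" where
  "charpoly A = det (mat [:0, 1:] - map_matrix (\<lambda>c. [:c:]) A)"

text \<open>All complex eigenvalues of a real matrix, with algebraic multiplicity.\<close>
definition eigenvalues :: "real^'n^'n \<Rightarrow> complex multiset" where
  "eigenvalues A = proots (charpoly (map_matrix complex_of_real A))"

text \<open>Morse index and coindex. These are only meant for symmetric matrices, for which
  all eigenvalues are roots of the real characteristic polynomial.\<close>
definition morse_index :: "real^'n^'n \<Rightarrow> nat" where
  "morse_index S = size (filter_mset (\<lambda>x. x < 0) (proots (charpoly S)))"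

definition morse_coindex :: "real^'n^'n \<Rightarrow> nat" where
  "morse_coindex S = size (filter_mset (\<lambda>x. x > 0) (proots (charpoly S)))"

text \<open>Index and coindex of the quadratic form of \<open>S\<close> restricted to the subspace \<open>X\<close>: the
  maximal dimension of a subspace of \<open>X\<close> on which the form is negative (positive) definite.
  The sets of dimensions are finite, and contain \<open>0\<close> when \<open>0 \<in> X\<close>.\<close>
definition morse_index_on :: "real^'n^'n \<Rightarrow> (real^'n) set \<Rightarrow> nat" where
  "morse_index_on S X =
     Max {dim V | V. subspace V \<and> V \<subseteq> X \<and> (\<forall>v\<in>V. v \<noteq> 0 \<longrightarrow> (S *v v) \<bullet> v < 0)}"

definition morse_coindex_on :: "real^'n^'n \<Rightarrow> (real^'n) set \<Rightarrow> nat" where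
  "morse_coindex_on S X =
     Max {dim V | V. subspace V \<and> V \<subseteq> X \<and> (\<forall>v\<in>V. v \<noteq> 0 \<longrightarrow> (S *v v) \<bullet> v > 0)}"

section \<open>Gradient and Hessian\<close>

definition grad :: "('a::real_inner \<Rightarrow> real) \<Rightarrow> 'a \<Rightarrow> 'a" where
  "grad f x = (THE D. GDERIV f x :> D)"

definition hessian :: "(real^'n \<Rightarrow> real) \<Rightarrow> real^'n \<Rightarrow> real^'n^'n" where
  "hessian f x = jacobian (grad f) (at x)"

section \<open>The planar vortex problem\<close>

text \<open>The vortices are indexed by a finite linearly ordered type \<open>'n\<close>, so that \<open>N = CARD('n)\<close>,
  and \<open>(\<real>\<^sup>2)\<^sup>N = \<real>\<^sup>2\<^sup>N\<close> is \<open>real^('n \<times> 2)\<close>: entry \<open>(i, a)\<close> is the \<open>a\<close>-th coordinate of the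
  \<open>i\<close>-th vortex. This matches the block structure of the Kronecker products below.\<close>

definition vortex :: "real^('n::finite \<times> 2) \<Rightarrow> 'n \<Rightarrow> real^2" where
  "vortex z i = (\<chi> a. z $ (i, a))"

definition config_space :: "(real^('n::finite \<times> 2)) set" where
  "config_space = {z. \<forall>i j. i \<noteq> j \<longrightarrow> vortex z i \<noteq> vortex z j}"

definition J :: "real^2^2" where
  "J = vector [vector [0, 1], vector [-1, 0]]"

definition K :: "real^('n::finite \<times> 2)^('n \<times> 2)" where
  "K = kron (mat 1) J"

definition circ_matrix :: "('n::finite \<Rightarrow> real) \<Rightarrow> real^('n \<times> 2)^('n \<times> 2)" where
  "circ_matrix \<Gamma> = kron (\<chi> i j. if i = j then \<Gamma> i else 0) (mat 1)"

definition hamiltonian :: "('n::{finite,linorder} \<Rightarrow> real) \<Rightarrow> real^('n \<times> 2) \<Rightarrow> real" where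
  "hamiltonian \<Gamma> z = - (\<Sum>(i, j)\<in>{(i, j). i < j}. \<Gamma> i * \<Gamma> j * ln (norm (vortex z i - vortex z j)))"

definition central_configuration ::
    "('n::{finite,linorder} \<Rightarrow> real) \<Rightarrow> real \<Rightarrow> real^('n \<times> 2) \<Rightarrow> bool" where
  "central_configuration \<Gamma> \<omega> \<xi> \<longleftrightarrow>
     \<xi> \<in> config_space \<and> grad (hamiltonian \<Gamma>) \<xi> + \<omega> *\<^sub>R (circ_matrix \<Gamma> *v \<xi>) = 0"

definition relative_equilibrium :: "real \<Rightarrow> real^('n::finite \<times> 2) \<Rightarrow> real \<Rightarrow> real^('n \<times> 2)" where
  "relative_equilibrium \<omega> \<xi> t = matrix_exp ((- \<omega> * t) *\<^sub>R K) *v \<xi>"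

definition stability_matrix ::
    "('n::{finite,linorder} \<Rightarrow> real) \<Rightarrow> real \<Rightarrow> real^('n \<times> 2) \<Rightarrow> real^('n \<times> 2)^('n \<times> 2)" where
  "stability_matrix \<Gamma> \<omega> \<xi> =
     K ** (matrix_inv (circ_matrix \<Gamma>) ** hessian (hamiltonian \<Gamma>) \<xi> + \<omega> *\<^sub>R mat 1)"

definition nontrivial_eigenvalues ::
    "('n::{finite,linorder} \<Rightarrow> real) \<Rightarrow> real \<Rightarrow> real^('n \<times> 2) \<Rightarrow> complex multiset" where
  "nontrivial_eigenvalues \<Gamma> \<omega> \<xi> =
     eigenvalues (stability_matrix \<Gamma> \<omega> \<xi>) - {#0, 0, \<i> * of_real \<omega>, - \<i> * of_real \<omega>#}"

text \<open>Properties of a relative equilibrium \<open>z\<close> with angular velocity \<open>\<omega>\<close>; the central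
  configuration generating \<open>z\<close> is \<open>z 0\<close>.\<close>
definition nondegenerate ::
    "('n::{finite,linorder} \<Rightarrow> real) \<Rightarrow> real \<Rightarrow> (real \<Rightarrow> real^('n \<times> 2)) \<Rightarrow> bool" where
  "nondegenerate \<Gamma> \<omega> z \<longleftrightarrow> (\<forall>\<mu> \<in># nontrivial_eigenvalues \<Gamma> \<omega> (z 0). \<mu> \<noteq> 0)"

definition spectrally_stable ::
    "('n::{finite,linorder} \<Rightarrow> real) \<Rightarrow> real \<Rightarrow> (real \<Rightarrow> real^('n \<times> 2)) \<Rightarrow> bool" where
  "spectrally_stable \<Gamma> \<omega> z \<longleftrightarrow> (\<forall>\<mu> \<in># nontrivial_eigenvalues \<Gamma> \<omega> (z 0). Re \<mu> = 0)"

definition A_hat ::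
    "('n::{finite,linorder} \<Rightarrow> real) \<Rightarrow> real \<Rightarrow> real^('n \<times> 2) \<Rightarrow> real^('n \<times> 2)^('n \<times> 2)" where
  "A_hat \<Gamma> \<omega> \<xi> = hessian (hamiltonian \<Gamma>) \<xi> + \<omega> *\<^sub>R circ_matrix \<Gamma>"

definition circ_orth ::
    "('n::finite \<Rightarrow> real) \<Rightarrow> (real^('n \<times> 2)) set \<Rightarrow> (real^('n \<times> 2)) set" where
  "circ_orth \<Gamma> W = {w. \<forall>v\<in>W. w \<bullet> (circ_matrix \<Gamma> *v v) = 0}"

lemma relative_equilibrium_0:
  fixes \<xi> :: "real^('n::finite \<times> 2)"
  shows "relative_equilibrium \<omega> \<xi> 0 = \<xi>"
proof -
  have "(\<lambda>k. (((**) (0 :: real^('n \<times> 2)^('n \<times> 2)) ^^ k) (mat 1)) /\<^sub>R fact k)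
      = (\<lambda>k. if k = 0 then mat 1 else 0)"
  proof
    fix k show "(((**) (0 :: real^('n \<times> 2)^('n \<times> 2)) ^^ k) (mat 1)) /\<^sub>R fact k
        = (if k = 0 then mat 1 else 0)"
      by (cases k) (simp_all add: matrix_matrix_mult_def vec_eq_iff)
  qed
  then have "matrix_exp (0 :: real^('n \<times> 2)^('n \<times> 2)) = mat 1"
    using suminf_finite[of "{0}" "\<lambda>k. if k = 0 then mat 1 else 0 :: real^('n \<times> 2)^('n \<times> 2)"]
    by (simp add: matrix_exp_def)
  then show ?thesis by (simp add: relative_equilibrium_def)
qed

end

theory Submission
  imports Defs
begin

text \<open>Put \<open>D = D\<^sup>2H(\<xi>)\<close> and \<open>S = M\<inverse> D\<close>. Since \<open>log\<close> is harmonic in the plane, \<open>K\<close> anticommutes with \<open>D\<close>,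
  so \<open>B\<^sup>2 = S\<^sup>2 - \<omega>\<^sup>2\<close>; moreover \<open>S \<xi> = \<omega> \<xi>\<close> and \<open>S K\<xi> = - \<omega> K\<xi>\<close>, so \<open>B\<^sup>2\<close> vanishes on \<open>W\<close>.
  Non-degeneracy forces \<open>W\<close> to be the whole generalised kernel of \<open>B\<close>, hence
  \<open>\<langle>M \<xi>, \<xi>\<rangle> \<noteq> 0\<close> and the space is the direct sum of \<open>W\<close> and \<open>W\<^sup>\<bottom>\<close>. A kernel vector of
  \<open>t D + \<omega> M\<close> in \<open>W\<^sup>\<bottom>\<close> for some \<open>0 < t \<le> 1\<close> would be an eigenvector of \<open>S\<close> for \<open>- \<omega> / t\<close>, making
  \<open>\<omega>\<^sup>2 / t\<^sup>2 - \<omega>\<^sup>2 \<ge> 0\<close> an eigenvalue of \<open>B\<^sup>2\<close>, against spectral stability and non-degeneracy.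
  Therefore the Morse index on \<open>W\<^sup>\<bottom>\<close> is constant along this path. On \<open>W\<close> the two forms are explicit.\<close>

section \<open>Index of quadratic forms\<close>

lemma inner_matrix_symmetric:
  fixes S :: "real^'n^'n"
  assumes "transpose S = S"
  shows "(S *v x) \<bullet> y = x \<bullet> (S *v y)"
  using assms by (metis dot_lmul_matrix transpose_matrix_vector)

lemma symmetric_matrixI:
  fixes S :: "real^'n^'n"
  assumes "\<And>x y. (S *v x) \<bullet> y = x \<bullet> (S *v y)"
  shows "transpose S = S"
proof -
  have "(transpose S *v x) \<bullet> y = (S *v x) \<bullet> y" for x y
    using assms by (metis dot_lmul_matrix transpose_matrix_vector)
  then have "transpose S *v x = S *v x" for x by (metis vector_eq_rdot)
  then show ?thesis unfolding matrix_eq by blast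
qed

text \<open>First-order optimality: near 0 the linear term dominates, so its coefficient must vanish
  at a maximum.\<close>

lemma linear_bound_by_quadratic_imp_zero:
  fixes a c :: real
  assumes "\<And>s. 2 * s * a + s\<^sup>2 * c \<le> 0"
  shows "a = 0"
proof (rule ccontr)
  assume a: "a \<noteq> 0"
  \<comment> \<open>With \<open>k\<close> larger than \<open>\<bar>c\<bar>\<close>, the point
    \<open>s = a / k\<close> is close enough to 0 for the linear term to win.\<close>
  define k where "k = \<bar>c\<bar> + 1"
  have k: "k > 0" "2 * k + c > 0" by (auto simp: k_def)
  have "2 * (a / k) * a + (a / k)\<^sup>2 * c = (a / k)\<^sup>2 * (2 * k + c)"
    using k by (simp add: power2_eq_square field_simps)
  also have "\<dots> > 0" using a k by simp
  finally show False using assms[of "a / k"] by simp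
qed

text \<open>Rayleigh's method: a maximiser \<open>b\<close> of the form on the unit sphere of
  \<open>X\<close> is \<open>S\<close>-orthogonal to every vector of \<open>X\<close> orthogonal to
  \<open>b\<close>, so one can induct on that complement. \<open>S\<close> may map \<open>X\<close>
  out of itself, so it is the form on \<open>X\<close>, rather than \<open>S\<close>, that is
  diagonalised.\<close>

lemma symmetric_form_orthonormal_basis:
  fixes S :: "real^'n^'n"
  assumes sym: "transpose S = S" and X: "subspace X"
  obtains B where "B \<subseteq> X" "pairwise orthogonal B" "\<And>b. b \<in> B \<Longrightarrow> norm b = 1" "span B = X"
    "pairwise (\<lambda>b c. (S *v b) \<bullet> c = 0) B"
proof -
  have "\<exists>B. B \<subseteq> X \<and> pairwise orthogonal B \<and> (\<forall>b\<in>B. norm b = 1) \<and> span B = X \<and>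
      pairwise (\<lambda>b c. (S *v b) \<bullet> c = 0) B"
    using X
  proof (induction "dim X" arbitrary: X rule: less_induct)
    case less
    show ?case
    proof (cases "X \<subseteq> {0}")
      case True
      then have "X = {0}" using subspace_0[OF less.prems] by auto
      then show ?thesis by (intro exI[of _ "{}"]) auto
    next
      case False
      let ?q = "\<lambda>x. (S *v x) \<bullet> x"
      obtain x0 where x0: "x0 \<in> X" "x0 \<noteq> 0" using False by auto
      have "compact (sphere 0 1 \<inter> X)"
        by (intro compact_Int_closed compact_sphere closed_subspace less.prems)
      moreover have "x0 /\<^sub>R norm x0 \<in> sphere 0 1 \<inter> X"
        using x0 less.prems by (simp add: subspace_scale)
      moreover have "continuous_on (sphere 0 1 \<inter> X) ?q"
        by (intro continuous_intros)
      ultimately obtain b where b: "b \<in> sphere 0 1 \<inter> X"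
        and max: "\<And>x. x \<in> sphere 0 1 \<inter> X \<Longrightarrow> ?q x \<le> ?q b"
        using continuous_attains_sup[of "sphere 0 1 \<inter> X" ?q] by blast
      have nb: "norm b = 1" and bX: "b \<in> X" using b by auto
      have bb: "b \<bullet> b = 1" using nb by (simp add: norm_eq_1)
      have le: "?q x \<le> ?q b * (x \<bullet> x)" if "x \<in> X" for x
      proof (cases "x = 0")
        case False
        let ?y = "x /\<^sub>R norm x"
        have "?q ?y \<le> ?q b"
          using False that less.prems by (intro max) (simp add: subspace_scale)
        moreover have "?q ?y = ?q x / (x \<bullet> x)"
          by (simp add: matrix_vector_mult_scaleR power2_norm_eq_inner[symmetric] power2_eq_square field_simps)
        ultimately have "?q x / (x \<bullet> x) \<le> ?q b" by simp
        then show ?thesis using False by (simp add: pos_divide_le_eq)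
      qed auto
      \<comment> \<open>Moving from \<open>b\<close> to \<open>b + s y\<close> changes the squared
        norm only to second order, so maximality kills the term of the form that is linear in
        \<open>s\<close>.\<close>
      have crit: "(S *v b) \<bullet> y = 0" if y: "y \<in> X" "b \<bullet> y = 0" for y
      proof (rule linear_bound_by_quadratic_imp_zero[where c = "?q y - ?q b * (y \<bullet> y)"])
        fix s :: real
        have "(S *v y) \<bullet> b = (S *v b) \<bullet> y"
          using inner_matrix_symmetric[OF sym] by (metis inner_commute)
        then have "?q (b + s *\<^sub>R y) = ?q b + 2 * s * ((S *v b) \<bullet> y) + s\<^sup>2 * ?q y"
          by (simp add: matrix_vector_right_distrib matrix_vector_mult_scaleR inner_simps
              power2_eq_square algebra_simps)
        moreover have "(b + s *\<^sub>R y) \<bullet> (b + s *\<^sub>R y) = 1 + s\<^sup>2 * (y \<bullet> y)"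
          using y(2) bb by (simp add: inner_simps inner_commute power2_eq_square)
        moreover have "b + s *\<^sub>R y \<in> X"
          using y bX less.prems by (simp add: subspace_add subspace_scale)
        ultimately show "2 * s * ((S *v b) \<bullet> y) + s\<^sup>2 * (?q y - ?q b * (y \<bullet> y)) \<le> 0"
          using le[of "b + s *\<^sub>R y"] by (simp add: algebra_simps)
      qed
      define Y where "Y = X \<inter> {y. b \<bullet> y = 0}"
      have sY: "subspace Y"
        unfolding Y_def by (intro subspace_inter less.prems subspace_hyperplane)
      have "b \<notin> Y" using bb by (auto simp: Y_def)
      then have "Y \<subset> X" using bX Y_def by blast
      then have "dim Y < dim X"
        by (metis dim_psubset sY less.prems span_eq_iff)
      from less.hyps[OF this sY] obtain B where B: "B \<subseteq> Y" "pairwise orthogonal B"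
        "\<forall>b\<in>B. norm b = 1" "span B = Y" "pairwise (\<lambda>b c. (S *v b) \<bullet> c = 0) B" by blast
      have "span (insert b B) = X"
      proof
        show "span (insert b B) \<subseteq> X"
          using B(1) bX less.prems by (intro span_minimal) (auto simp: Y_def)
        show "X \<subseteq> span (insert b B)"
        proof
          fix x assume "x \<in> X"
          then have "x - (b \<bullet> x) *\<^sub>R b \<in> Y"
            using bX bb less.prems by (simp add: Y_def subspace_diff subspace_scale inner_simps)
          then have "x - (b \<bullet> x) *\<^sub>R b \<in> span B" using B(4) by simp
          then show "x \<in> span (insert b B)"
            using span_breakdown_eq by blast
        qed
      qed
      moreover have "(S *v b) \<bullet> c = 0 \<and> (S *v c) \<bullet> b = 0 \<and> orthogonal b c \<and> orthogonal c b"
        if "c \<in> B" for c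
      proof -
        have "c \<in> X" "b \<bullet> c = 0" using that B(1) by (auto simp: Y_def)
        then show ?thesis using crit[of c] inner_matrix_symmetric[OF sym]
          by (metis inner_commute orthogonal_def)
      qed
      ultimately show ?thesis
        using B bX nb by (intro exI[of _ "insert b B"]) (auto simp: pairwise_insert Y_def)
    qed
  qed
  then show ?thesis using that by blast
qed

lemma orthonormal_independent:
  fixes B :: "'a::euclidean_space set"
  assumes "pairwise orthogonal B" "\<And>b. b \<in> B \<Longrightarrow> norm b = 1"
  shows "independent B"
  using assms by (intro pairwise_orthogonal_independent) force+

section \<open>Index of a form on a subspace and the law of inertia\<close>

lemma finite_negative_dims:
  fixes S :: "real^'n^'n"
  shows "finite {dim V |V. subspace V \<and> V \<subseteq> X \<and> (\<forall>v\<in>V. v \<noteq> 0 \<longrightarrow> (S *v v) \<bullet> v < 0)}"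
  by (rule finite_subset[of _ "{..DIM(real^'n)}"]) (auto intro: dim_subset_UNIV[THEN order_trans])

lemma morse_index_on_eqI:
  fixes S :: "real^'n^'n"
  assumes "subspace V" "V \<subseteq> X" "\<And>v. v \<in> V \<Longrightarrow> v \<noteq> 0 \<Longrightarrow> (S *v v) \<bullet> v < 0"
    and "\<And>U. subspace U \<Longrightarrow> U \<subseteq> X \<Longrightarrow> (\<And>v. v \<in> U \<Longrightarrow> v \<noteq> 0 \<Longrightarrow> (S *v v) \<bullet> v < 0) \<Longrightarrow> dim U \<le> dim V"
  shows "morse_index_on S X = dim V"
  unfolding morse_index_on_def
  by (rule Max_eqI) (use assms finite_negative_dims in blast)+

lemma morse_index_on_ge:
  fixes S :: "real^'n^'n"
  assumes "subspace V" "V \<subseteq> X" "\<And>v. v \<in> V \<Longrightarrow> v \<noteq> 0 \<Longrightarrow> (S *v v) \<bullet> v < 0"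
  shows "dim V \<le> morse_index_on S X"
  unfolding morse_index_on_def
  by (rule Max_ge[OF finite_negative_dims]) (use assms in blast)

lemma morse_index_on_attained:
  fixes S :: "real^'n^'n"
  assumes "subspace X"
  obtains V where "subspace V" "V \<subseteq> X" "\<And>v. v \<in> V \<Longrightarrow> v \<noteq> 0 \<Longrightarrow> (S *v v) \<bullet> v < 0"
    "dim V = morse_index_on S X"
proof -
  let ?D = "{dim V |V. subspace V \<and> V \<subseteq> X \<and> (\<forall>v\<in>V. v \<noteq> 0 \<longrightarrow> (S *v v) \<bullet> v < 0)}"
  have "finite ?D" by (rule finite_negative_dims)
  \<comment> \<open>The zero subspace makes the set nonempty, so that \<open>Max\<close> is
    attained.\<close>
  moreover have "dim {0::real^'n} \<in> ?D"
    using assms by (auto intro!: exI[of _ "{0}"] simp: subspace_0)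
  ultimately have "Max ?D \<in> ?D" by (intro Max_in) auto
  then show ?thesis using that unfolding morse_index_on_def by auto
qed

lemma form_sum_orthogonal:
  fixes S :: "real^'n^'n"
  assumes fin: "finite B" and orth: "pairwise (\<lambda>b c. (S *v b) \<bullet> c = 0) B"
  shows "(S *v (\<Sum>b\<in>B. r b *\<^sub>R b)) \<bullet> (\<Sum>b\<in>B. r b *\<^sub>R b) = (\<Sum>b\<in>B. (r b)\<^sup>2 * ((S *v b) \<bullet> b))"
proof -
  have "(S *v (\<Sum>b\<in>B. r b *\<^sub>R b)) \<bullet> (\<Sum>b\<in>B. r b *\<^sub>R b) =
      (\<Sum>c\<in>B. \<Sum>b\<in>B. r b * r c * ((S *v b) \<bullet> c))"
    by (simp add: linear_sum[OF matrix_vector_mul_linear] inner_sum_left inner_sum_right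
        matrix_vector_mult_scaleR sum_distrib_left algebra_simps)
  also have "\<dots> = (\<Sum>c\<in>B. \<Sum>b\<in>B. if b = c then (r b)\<^sup>2 * ((S *v b) \<bullet> b) else 0)"
    using orth by (intro sum.cong) (auto simp: pairwise_def power2_eq_square)
  finally show ?thesis using fin by simp
qed

text \<open>Sylvester's law of inertia: the span of the negative vectors of an orthogonal basis is a
  negative definite subspace, and every other one meets the span of the remaining vectors only in \<open>0\<close>.\<close>
lemma morse_index_on_span:
  fixes S :: "real^'n^'n"
  assumes ind: "independent B" and orth: "pairwise (\<lambda>b c. (S *v b) \<bullet> c = 0) B"
  shows "morse_index_on S (span B) = card {b\<in>B. (S *v b) \<bullet> b < 0}"
proof -
  define N where "N = {b\<in>B. (S *v b) \<bullet> b < 0}"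
  have fin: "finite B" using ind finiteI_independent by blast
  have finN: "finite N" "finite (B - N)" using fin by (auto simp: N_def)
  have indN: "independent N" "independent (B - N)"
    using ind by (rule independent_mono; auto simp: N_def)+
  have orthN: "pairwise (\<lambda>b c. (S *v b) \<bullet> c = 0) N" "pairwise (\<lambda>b c. (S *v b) \<bullet> c = 0) (B - N)"
    using orth by (auto simp: N_def intro: pairwise_subset)
  have neg: "(S *v v) \<bullet> v < 0" if vN: "v \<in> span N" and v0: "v \<noteq> 0" for v
  proof -
    obtain r where v: "v = (\<Sum>b\<in>N. r b *\<^sub>R b)"
      using vN unfolding span_finite[OF finN(1)] by blast
    obtain b where b: "b \<in> N" "r b \<noteq> 0"
    proof (rule ccontr)
      assume "\<not> thesis"
      then have "\<And>b. b \<in> N \<Longrightarrow> r b = 0" using that by blast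
      then show False using v0 v by simp
    qed
    have "(\<Sum>b\<in>N. (r b)\<^sup>2 * ((S *v b) \<bullet> b)) < (\<Sum>b\<in>N. 0)"
      using b finN(1)
      by (intro sum_strict_mono_ex1)
        (auto simp: N_def mult_nonneg_nonpos intro!: bexI[of _ b] mult_pos_neg)
    then show ?thesis
      unfolding v form_sum_orthogonal[OF finN(1) orthN(1)] by simp
  qed
  have nonneg: "(S *v v) \<bullet> v \<ge> 0" if vB: "v \<in> span (B - N)" for v
  proof -
    obtain r where v: "v = (\<Sum>b\<in>B - N. r b *\<^sub>R b)"
      using vB unfolding span_finite[OF finN(2)] by blast
    show ?thesis
      unfolding v form_sum_orthogonal[OF finN(2) orthN(2)]
      by (intro sum_nonneg) (auto simp: N_def)
  qed
  have dimN: "dim (span N) = card N" using indN(1) by (rule dim_span_eq_card_independent)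
  have "morse_index_on S (span B) = dim (span N)"
  proof (rule morse_index_on_eqI)
    show "span N \<subseteq> span B" by (intro span_mono) (auto simp: N_def)
    fix U assume U: "subspace U" "U \<subseteq> span B" "\<And>v. v \<in> U \<Longrightarrow> v \<noteq> 0 \<Longrightarrow> (S *v v) \<bullet> v < 0"
    have "U \<inter> span (B - N) \<subseteq> {0}"
      using U(3) nonneg by force
    then have d0: "dim (U \<inter> span (B - N)) = 0" by (simp only: dim_eq_0)
    have "dim U + card (B - N) = dim {x + y |x y. x \<in> U \<and> y \<in> span (B - N)}"
      using dim_sums_Int[OF U(1) subspace_span, of "B - N"]
        dim_span_eq_card_independent[OF indN(2)] by (simp only: d0)
    also have "\<dots> \<le> dim (span B)"
    proof (rule dim_subset, rule subsetI)
      fix w assume "w \<in> {x + y |x y. x \<in> U \<and> y \<in> span (B - N)}"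
      then obtain x y where "w = x + y" "x \<in> span B" "y \<in> span B"
        using U(2) span_mono[OF Diff_subset, of B N] by blast
      then show "w \<in> span B" by (simp add: span_add)
    qed
    also have "\<dots> = card N + card (B - N)"
    proof -
      have "card B = card N + card (B - N)"
        using finN fin card_Un_disjoint[of N "B - N"] Un_absorb1[of N B] by (simp add: N_def)
      then show ?thesis using dim_span_eq_card_independent[OF ind] by simp
    qed
    finally show "dim U \<le> dim (span N)" using dimN by simp
  qed (use neg in auto)
  then show ?thesis using dimN by (simp add: N_def)
qed

lemma matrix_vector_mult_minus_left: "(- S) *v x = - ((S :: real^'n^'m) *v x)"
  by (simp add: matrix_vector_mult_def vec_eq_iff sum_negf)

text \<open>In a diagonalising basis an isotropic vector would be \<open>S\<close>-orthogonal to all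
  of \<open>X\<close>. Nondegeneracy excludes this, so each basis vector is counted exactly once, by
  the index or by the coindex.\<close>

lemma morse_index_on_plus_coindex:
  fixes S :: "real^'n^'n"
  assumes sym: "transpose S = S" and X: "subspace X"
    and nondeg: "\<And>x. x \<in> X \<Longrightarrow> (\<And>y. y \<in> X \<Longrightarrow> (S *v x) \<bullet> y = 0) \<Longrightarrow> x = 0"
  shows "morse_index_on S X + morse_index_on (- S) X = dim X"
proof -
  obtain B where B: "B \<subseteq> X" "pairwise orthogonal B" "\<And>b. b \<in> B \<Longrightarrow> norm b = 1" "span B = X"
    "pairwise (\<lambda>b c. (S *v b) \<bullet> c = 0) B"
    using symmetric_form_orthonormal_basis[OF sym X] by blast
  have ind: "independent B" using B(2,3) by (rule orthonormal_independent)
  have "(S *v b) \<bullet> b \<noteq> 0" if b: "b \<in> B" for b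
  proof
    assume 0: "(S *v b) \<bullet> b = 0"
    have "(S *v b) \<bullet> y = 0" if "y \<in> X" for y
    proof -
      have "y \<in> span B" using that B(4) by simp
      then show ?thesis
        by (induction rule: span_induct_alt) (use B(5) b 0 in \<open>auto simp: inner_simps pairwise_def\<close>)
    qed
    then have "b = 0" using nondeg b B(1) by auto
    then show False using B(3)[OF b] by simp
  qed
  then have "B = {b\<in>B. (S *v b) \<bullet> b < 0} \<union> {b\<in>B. ((- S) *v b) \<bullet> b < 0}"
    by (force simp: matrix_vector_mult_minus_left)
  then have "card B = card ({b\<in>B. (S *v b) \<bullet> b < 0} \<union> {b\<in>B. ((- S) *v b) \<bullet> b < 0})"
    by simp
  also have "\<dots> = card {b\<in>B. (S *v b) \<bullet> b < 0} + card {b\<in>B. ((- S) *v b) \<bullet> b < 0}"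
    using finiteI_independent[OF ind]
    by (intro card_Un_disjoint) (auto simp: matrix_vector_mult_minus_left)
  also have "\<dots> = morse_index_on S X + morse_index_on (- S) X"
    using morse_index_on_span[OF ind, of S] morse_index_on_span[OF ind, of "- S"] B(4,5)
    by (simp add: matrix_vector_mult_minus_left)
  finally show ?thesis using ind B(4) by (metis dim_span_eq_card_independent)
qed

section \<open>Semicontinuity and homotopy invariance of the index\<close>

text \<open>A maximal negative definite subspace \<open>V\<close> survives small perturbations: by
  compactness \<open>P\<close> is at most \<open>- c\<close> and \<open>Q\<close> is bounded by
  \<open>b\<close> on the unit sphere of \<open>V\<close>, so \<open>\<bar>t\<bar> < c / b\<close>
  suffices.\<close>

lemma morse_index_on_lower_semicontinuous:
  fixes P Q :: "real^'n^'n"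
  assumes X: "subspace X"
  shows "\<exists>e>0. \<forall>t. \<bar>t\<bar> < e \<longrightarrow> morse_index_on P X \<le> morse_index_on (P + t *\<^sub>R Q) X"
proof -
  obtain V where V: "subspace V" "V \<subseteq> X" "\<And>v. v \<in> V \<Longrightarrow> v \<noteq> 0 \<Longrightarrow> (P *v v) \<bullet> v < 0"
    "dim V = morse_index_on P X"
    using morse_index_on_attained[OF X] by blast
  let ?C = "sphere 0 1 \<inter> V"
  have C: "compact ?C"
    by (intro compact_Int_closed compact_sphere closed_subspace V)
  have cont: "continuous_on ?C (\<lambda>v. (A *v v) \<bullet> v)" for A :: "real^'n^'n"
    by (intro continuous_intros)
  \<comment> \<open>If \<open>V\<close> is the zero subspace, the sphere is empty and
    \<open>c = 1\<close> serves as a default.\<close>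
  have "\<exists>c>0. \<forall>v\<in>?C. (P *v v) \<bullet> v \<le> - c"
  proof (cases "?C = {}")
    case False
    obtain u where "u \<in> ?C" "\<forall>v\<in>?C. (P *v v) \<bullet> v \<le> (P *v u) \<bullet> u"
      using continuous_attains_sup[OF C False cont] by blast
    moreover have "(P *v u) \<bullet> u < 0" using \<open>u \<in> ?C\<close> by (intro V) auto
    ultimately show ?thesis by (intro exI[of _ "- ((P *v u) \<bullet> u)"]) auto
  qed (auto intro: exI[of _ 1])
  then obtain c where c: "c > 0" "\<And>v. v \<in> ?C \<Longrightarrow> (P *v v) \<bullet> v \<le> - c" by blast
  have "bounded ((\<lambda>v. (Q *v v) \<bullet> v) ` ?C)"
    using compact_continuous_image[OF cont C] compact_imp_bounded by blast
  then obtain b where b: "b > 0" "\<And>v. v \<in> ?C \<Longrightarrow> \<bar>(Q *v v) \<bullet> v\<bar> \<le> b"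
    unfolding bounded_pos by auto
  show ?thesis
  proof (intro exI[of _ "c / b"] conjI allI impI)
    show "c / b > 0" using b c by simp
    fix t :: real assume t: "\<bar>t\<bar> < c / b"
    have "((P + t *\<^sub>R Q) *v v) \<bullet> v < 0" if v: "v \<in> V" "v \<noteq> 0" for v
    proof -
      define u where "u = v /\<^sub>R norm v"
      have u: "u \<in> ?C" using v V(1) by (simp add: u_def subspace_scale)
      have "((P + t *\<^sub>R Q) *v u) \<bullet> u = (P *v u) \<bullet> u + t * ((Q *v u) \<bullet> u)"
        by (simp add: matrix_vector_mult_add_rdistrib inner_simps scaleR_matrix_vector_assoc[symmetric])
      also have "\<dots> \<le> - c + \<bar>t\<bar> * b"
      proof (rule add_mono)
        show "t * ((Q *v u) \<bullet> u) \<le> \<bar>t\<bar> * b"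
          using mult_left_mono[OF b(2)[OF u], of "\<bar>t\<bar>"] abs_ge_self[of "t * ((Q *v u) \<bullet> u)"]
          by (simp add: abs_mult)
      qed (rule c(2)[OF u])
      also have "\<dots> < 0" using t b by (simp add: field_simps)
      finally have "((P + t *\<^sub>R Q) *v u) \<bullet> u < 0" .
      moreover have "((P + t *\<^sub>R Q) *v u) \<bullet> u = (((P + t *\<^sub>R Q) *v v) \<bullet> v) / (norm v)\<^sup>2"
        by (simp add: u_def matrix_vector_mult_scaleR power2_eq_square field_simps)
      ultimately show ?thesis using v by (simp add: divide_less_0_iff)
    qed
    then show "morse_index_on P X \<le> morse_index_on (P + t *\<^sub>R Q) X"
      using morse_index_on_ge[OF V(1,2)] V(4) by metis
  qed
qed

text \<open>Index and coindex are lower semicontinuous and add up to the dimension as long as the form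
  stays nondegenerate, so both are locally constant.\<close>
lemma morse_index_on_homotopy:
  fixes P Q :: "real^'n^'n"
  assumes sym: "transpose P = P" "transpose Q = Q" and X: "subspace X"
    and nondeg: "\<And>t x. t \<in> {0..1} \<Longrightarrow> x \<in> X \<Longrightarrow>
      (\<And>y. y \<in> X \<Longrightarrow> ((P + t *\<^sub>R Q) *v x) \<bullet> y = 0) \<Longrightarrow> x = 0"
  shows "morse_index_on P X = morse_index_on (P + Q) X"
proof -
  define f where "f t = morse_index_on (P + t *\<^sub>R Q) X" for t
  define g where "g t = morse_index_on (- (P + t *\<^sub>R Q)) X" for t
  have fg: "f t + g t = dim X" if "t \<in> {0..1}" for t
    unfolding f_def g_def
  proof (rule morse_index_on_plus_coindex[OF _ X])
    show "transpose (P + t *\<^sub>R Q) = P + t *\<^sub>R Q"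
      using sym by (simp add: transpose_def vec_eq_iff)
  qed (use nondeg[OF that] in blast)
  have "f 0 = f 1"
  proof (rule connected_local_const[where A = "{0..1}" and f = f])
    show "\<forall>a\<in>{0..1}. \<forall>\<^sub>F b in at a within {0..1}. f a = f b"
    proof
      fix a :: real assume a: "a \<in> {0..1}"
      obtain d where d: "d > 0" "\<And>t. \<bar>t\<bar> < d \<Longrightarrow> f a \<le> morse_index_on (P + a *\<^sub>R Q + t *\<^sub>R Q) X"
        using morse_index_on_lower_semicontinuous[OF X, of "P + a *\<^sub>R Q" Q] unfolding f_def by blast
      obtain e where e: "e > 0" "\<And>t. \<bar>t\<bar> < e \<Longrightarrow> g a \<le> morse_index_on (- (P + a *\<^sub>R Q) + t *\<^sub>R (- Q)) X"
        using morse_index_on_lower_semicontinuous[OF X, of "- (P + a *\<^sub>R Q)" "- Q"] unfolding g_def by blast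
      have "f a = f b" if b: "b \<in> {0..1}" "dist b a < min d e" for b
      proof -
        have "f a \<le> f b"
          using d(2)[of "b - a"] b(2) by (simp add: f_def dist_real_def algebra_simps)
        moreover have "g a \<le> g b"
          using e(2)[of "b - a"] b(2) by (simp add: g_def dist_real_def algebra_simps)
        \<comment> \<open>Neither summand can decrease and the sum is fixed, so both stay
          equal.\<close>
        ultimately show ?thesis using fg[OF a] fg[OF b(1)] by linarith
      qed
      then show "\<forall>\<^sub>F b in at a within {0..1}. f a = f b"
        unfolding eventually_at using d(1) e(1) by (intro exI[of _ "min d e"]) auto
    qed
  qed auto
  then show ?thesis by (simp add: f_def)
qed

lemma morse_index_on_cong:
  assumes "\<And>v. v \<in> X \<Longrightarrow> (S *v v) \<bullet> v < 0 \<longleftrightarrow> (S' *v v) \<bullet> v < 0"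
  shows "morse_index_on S X = morse_index_on S' X"
proof -
  have "{dim V |V. subspace V \<and> V \<subseteq> X \<and> (\<forall>v\<in>V. v \<noteq> 0 \<longrightarrow> (S *v v) \<bullet> v < 0)} =
      {dim V |V. subspace V \<and> V \<subseteq> X \<and> (\<forall>v\<in>V. v \<noteq> 0 \<longrightarrow> (S' *v v) \<bullet> v < 0)}"
    using assms by (intro Collect_cong ex_cong1) blast
  then show ?thesis by (simp add: morse_index_on_def)
qed

lemma morse_coindex_on_eq: "morse_coindex_on S X = morse_index_on (- S) X"
  by (simp add: morse_coindex_on_def morse_index_on_def matrix_vector_mult_minus_left)

lemma morse_index_on_scaleR:
  shows "c > 0 \<Longrightarrow> morse_index_on (c *\<^sub>R S) X = morse_index_on S X"
    and "c < 0 \<Longrightarrow> morse_index_on (c *\<^sub>R S) X = morse_index_on (- S) X"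
  by (intro morse_index_on_cong;
      simp add: scaleR_matrix_vector_assoc[symmetric] matrix_vector_mult_minus_left
        mult_less_0_iff zero_less_mult_iff)+

section \<open>Characteristic polynomials\<close>

lemma additive_sum:
  fixes h :: "'a::ab_group_add \<Rightarrow> 'b::ab_group_add"
  assumes "\<And>a b. h (a + b) = h a + h b"
  shows "h (sum f A) = (\<Sum>x\<in>A. h (f x))"
  using sum_comp_morphism[of h f A] assms by (metis (mono_tags, lifting) add_cancel_left_left comp_apply sum.cong)

lemma map_matrix_mult:
  fixes h :: "'a::comm_ring_1 \<Rightarrow> 'b::comm_ring_1"
  assumes "\<And>a b. h (a + b) = h a + h b" "\<And>a b. h (a * b) = h a * h b"
  shows "map_matrix h (A ** B) = map_matrix h A ** map_matrix h B"
  by (simp add: vec_eq_iff matrix_matrix_mult_def additive_sum[OF assms(1)] assms(2))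

text \<open>The determinant is a polynomial in the entries with integer coefficients. This is
  applied to evaluation and composition of polynomials, to constant polynomials, and to the
  embedding of the reals into the complex numbers.\<close>

lemma det_map_matrix:
  fixes h :: "'a::comm_ring_1 \<Rightarrow> 'b::comm_ring_1"
  assumes add: "\<And>a b. h (a + b) = h a + h b" and mult: "\<And>a b. h (a * b) = h a * h b"
    and one: "h 1 = 1"
  shows "det (map_matrix h A) = h (det A)"
proof -
  have zero: "h 0 = 0" using add[of 0 0] by simp
  have uminus: "h (- a) = - h a" for a
    using add[of "- a" a] zero by (simp add: eq_neg_iff_add_eq_0)
  have prod: "h (prod f I) = (\<Prod>i\<in>I. h (f i))" if "finite I" for f and I :: "'c set"
    using that by induction (simp_all add: mult one)
  have sign: "h (of_int (sign p)) = of_int (sign p)" for p :: "'c \<Rightarrow> 'c"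
    by (simp add: sign_def one uminus)
  show ?thesis
    by (simp add: det_def additive_sum[OF add] mult sign prod)
qed

abbreviation const_matrix :: "'a::comm_ring_1^'n^'m \<Rightarrow> 'a poly^'n^'m" where
  "const_matrix \<equiv> map_matrix (\<lambda>c. [:c:])"

lemma const_matrix_mult: "const_matrix (A ** B) = const_matrix A ** const_matrix B"
  by (rule map_matrix_mult) simp_all

lemma det_const_matrix: "det (const_matrix A) = [:det A:]"
  by (rule det_map_matrix) (simp_all add: one_pCons)

lemma poly_charpoly: "poly (charpoly A) x = det (mat x - A)"
proof -
  have "map_matrix (\<lambda>p. poly p x) (mat [:0, 1:] - const_matrix A) = mat x - A"
    by (simp add: vec_eq_iff mat_def)
  then show ?thesis
    unfolding charpoly_def by (subst det_map_matrix[symmetric, where h = "\<lambda>p. poly p x"]) simp_all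
qed

lemma pcompose_charpoly: "pcompose (charpoly A) q = det (mat q - const_matrix A)"
proof -
  have "map_matrix (\<lambda>p. pcompose p q) (mat [:0, 1:] - const_matrix A) = mat q - const_matrix A"
    by (simp add: vec_eq_iff mat_def pcompose_diff pcompose_pCons)
  then show ?thesis
    unfolding charpoly_def
    by (subst det_map_matrix[symmetric, where h = "\<lambda>p. pcompose p q"])
      (simp_all add: pcompose_add pcompose_mult pcompose_1)
qed

lemma matrix_diff_ldistrib: "A ** (B - C) = A ** B - A ** (C :: 'a::ring_1^'n^'m)"
  by (simp add: matrix_matrix_mult_def vec_eq_iff right_diff_distrib sum_subtractf)

lemma matrix_diff_rdistrib: "(A - B) ** C = A ** C - B ** (C :: 'a::ring_1^'n^'m)"
  by (simp add: matrix_matrix_mult_def vec_eq_iff left_diff_distrib sum_subtractf)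

lemma mat_mult_eq: "mat c ** A = (\<chi> i j. c * (A $ i $ j :: 'a::comm_ring_1))"
  by (simp add: matrix_matrix_mult_def mat_def vec_eq_iff if_distrib[of "\<lambda>x. x * _"] cong: if_cong)

lemma mult_mat_eq: "A ** mat c = (\<chi> i j. c * (A $ i $ j :: 'a::comm_ring_1))"
  by (simp add: matrix_matrix_mult_def mat_def vec_eq_iff if_distrib[of "\<lambda>x. _ * x"] mult.commute cong: if_cong)

text \<open>If \<open>charpoly A\<close> vanished, then so would the polynomial \<open>det (1 - y A)\<close> in \<open>y\<close>, whose value at
  \<open>0\<close> is \<open>1\<close>.\<close>
lemma charpoly_nonzero:
  fixes A :: "'a::field_char_0^'n^'n"
  shows "charpoly A \<noteq> 0"
proof
  assume 0: "charpoly A = 0"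
  define q where "q = det (mat 1 - mat [:0, 1:] ** const_matrix A)"
  have q: "poly q y = det (mat 1 - mat y ** A)" for y
  proof -
    have "map_matrix (\<lambda>p. poly p y) (mat 1 - mat [:0, 1:] ** const_matrix A) = mat 1 - mat y ** A"
      unfolding mat_mult_eq by (simp add: vec_eq_iff mat_def)
    then show ?thesis
      unfolding q_def by (subst det_map_matrix[symmetric, where h = "\<lambda>p. poly p y"]) simp_all
  qed
  have "poly q y = 0" if "y \<noteq> 0" for y
  proof -
    have "mat 1 - mat y ** A = mat y ** (mat (1 / y) - A)"
      using that unfolding mat_mult_eq by (simp add: vec_eq_iff mat_def algebra_simps)
    then show ?thesis
      using 0 poly_charpoly[of A "1 / y"] by (simp add: q det_mul)
  qed
  then have "- {0} \<subseteq> {y. poly q y = 0}" by auto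
  moreover have "infinite (- {0::'a})"
    by (metis Compl_eq_Diff_UNIV infinite_UNIV_char_0 finite.emptyI finite_Diff2 finite_insert)
  ultimately have "q = 0" using poly_roots_finite finite_subset by blast
  moreover have "poly q 0 = 1"
  proof -
    have "mat 1 - mat 0 ** A = mat 1" unfolding mat_mult_eq by (simp add: vec_eq_iff)
    then show ?thesis by (simp add: q)
  qed
  ultimately show False by simp
qed

lemma charpoly_similar:
  fixes Q P S :: "'a::comm_ring_1^'n^'n"
  assumes "Q ** P = mat 1"
  shows "charpoly (Q ** S ** P) = charpoly S"
proof -
  have 1: "const_matrix Q ** const_matrix P = mat 1"
    unfolding const_matrix_mult[symmetric] assms by (simp add: mat_def vec_eq_iff one_pCons)
  have "mat [:0, 1:] - const_matrix (Q ** S ** P) =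
      const_matrix Q ** (mat [:0, 1:] - const_matrix S) ** const_matrix P"
  proof -
    have "mat [:0, 1:] ** const_matrix P = const_matrix P ** mat [:0, 1:]"
      by (simp only: mat_mult_eq mult_mat_eq)
    then have "const_matrix Q ** mat [:0, 1:] ** const_matrix P = mat [:0, 1:]"
      using 1 by (simp add: matrix_mul_assoc[symmetric]) (simp add: matrix_mul_assoc)
    then show ?thesis
      by (simp add: const_matrix_mult matrix_diff_ldistrib matrix_diff_rdistrib)
  qed
  then have "charpoly (Q ** S ** P) = (det (const_matrix Q) * det (const_matrix P)) * charpoly S"
    by (simp add: charpoly_def det_mul mult_ac)
  also have "det (const_matrix Q) * det (const_matrix P) = 1"
    using 1 by (metis det_I det_mul)
  finally show ?thesis by simp
qed

section \<open>Multiplicity of the eigenvalue zero\<close>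

text \<open>The columns in \<open>I\<close> of \<open>(X - C) P\<close> are \<open>X\<close> times
  those of \<open>P\<close>, because \<open>C P\<close> vanishes there. Pulling \<open>X\<close> out
  of each gives \<open>(X - C) P = Y D\<close> with \<open>det D = X ^ card I\<close>, and
  \<open>det P\<close> is a nonzero constant.\<close>

lemma power_dvd_charpoly:
  fixes C P :: "'a::field^'n^'n"
  assumes P: "det P \<noteq> 0" and I: "\<And>i j. i \<in> I \<Longrightarrow> (C ** P) $ j $ i = 0"
  shows "[:0, 1:] ^ card I dvd charpoly C"
proof -
  let ?L = "(mat [:0, 1:] - const_matrix C) ** const_matrix P"
  define Y where "Y = (\<chi> j i. if i \<in> I then [:P $ j $ i:] else ?L $ j $ i)"
  define D where "D = (\<chi> j i. if j = i then (if i \<in> I then [:0, 1:] else 1) else (0 :: 'a poly))"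
  have L: "?L $ j $ i = [:0, 1:] * [:P $ j $ i:] - [:(C ** P) $ j $ i:]" for i j
    by (simp add: matrix_diff_rdistrib mat_mult_eq const_matrix_mult[symmetric])
  have "(Y ** D) $ j $ i = Y $ j $ i * (if i \<in> I then [:0, 1:] else 1)" for i j
    by (simp add: matrix_matrix_mult_def D_def if_distrib[of "\<lambda>x. _ * x"] cong: if_cong)
  then have "?L = Y ** D"
    by (simp only: vec_eq_iff) (auto simp: Y_def L I)
  then have "charpoly C * [:det P:] = det Y * det D"
    by (metis charpoly_def det_const_matrix det_mul)
  also have "det D = (\<Prod>i\<in>UNIV. if i \<in> I then [:0, 1:] else 1)"
    by (subst det_diagonal) (simp_all add: D_def)
  also have "\<dots> = [:0, 1:] ^ card I"
    by (simp add: prod.If_cases)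
  finally have "[:0, 1:] ^ card I dvd smult (det P) (charpoly C)"
    by (simp add: mult.commute)
  then show ?thesis using P by (simp add: dvd_smult_cancel)
qed

text \<open>The order of the root \<open>0\<close> is the same for \<open>B\<close> and \<open>B\<^sup>2\<close>, because
  \<open>det (x\<^sup>2 - B\<^sup>2) = det (x - B) det (x + B)\<close>.\<close>
lemma power_dvd_charpoly_of_square:
  fixes B :: "'a::field_char_0^'n^'n"
  assumes "[:0, 1:] ^ d dvd charpoly (B ** B)"
  shows "[:0, 1:] ^ d dvd charpoly B"
proof -
  define p where "p = charpoly B"
  \<comment> \<open>The sign coming from
    \<open>(X - B) (- X - B) = - (X\<^sup>2 - B\<^sup>2)\<close>.\<close>
  define c where "c = det (mat (- 1) :: 'a poly^'n^'n)"
  have sq: "c * pcompose (charpoly (B ** B)) [:0, 0, 1:] = p * pcompose p [:0, - 1:]"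
  proof -
    have "mat (- 1) ** (mat [:0, 0, 1:] - const_matrix (B ** B)) =
       (mat [:0, 1:] - const_matrix B) ** (mat [:0, - 1:] - const_matrix B)"
      by (simp add: matrix_diff_rdistrib matrix_diff_ldistrib const_matrix_mult mat_mult_eq mult_mat_eq)
        (simp add: vec_eq_iff mat_def one_pCons)
    then show ?thesis
      unfolding c_def p_def pcompose_charpoly unfolding charpoly_def det_mul[symmetric] by (rule arg_cong)
  qed
  obtain s where s: "charpoly (B ** B) = [:0, 1:] ^ d * s" using assms by blast
  have "p \<noteq> 0" by (simp add: p_def charpoly_nonzero)
  define m where "m = order 0 p"
  obtain q where q: "p = [:0, 1:] ^ m * q" "\<not> [:0, 1:] dvd q"
    using order_decomp[OF \<open>p \<noteq> 0\<close>, of 0] by (auto simp: m_def)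
  have q0: "poly q 0 \<noteq> 0" using q(2) poly_eq_0_iff_dvd[of q 0] by simp
  have "d \<le> m"
  proof (rule ccontr)
    assume "\<not> d \<le> m"
    then obtain k where k: "d = m + Suc k" using less_imp_Suc_add[of m d] by auto
    define X where "X = [:0, 1 :: 'a:]"
    have X: "[:0, 0, 1:] = X * X" "[:0, - 1:] = - X" "X \<noteq> 0" by (simp_all add: X_def)
    have pow: "pcompose (X ^ j) r = r ^ j" for j r
      by (induction j) (simp_all add: X_def pcompose_mult pcompose_pCons pcompose_1)
    have s': "charpoly (B ** B) = X ^ d * s" and q': "p = X ^ m * q"
      using s q(1) by (simp_all add: X_def)
    \<comment> \<open>Comparing orders at 0: the left side is divisible by \<open>X\<^sup>2\<close>
      to the power \<open>d\<close>, while \<open>p(X) p(-X)\<close> has order exactly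
      \<open>2 m\<close>. After cancelling, the left side vanishes at 0 and the right side is
      \<open>q(0)\<^sup>2\<close> up to sign.\<close>
    have "(X * X) ^ m * (c * ((X * X) ^ Suc k * pcompose s (X * X))) =
        c * ((X * X) ^ d * pcompose s (X * X))"
      unfolding k power_add by (simp only: mult_ac)
    also have "\<dots> = X ^ m * q * ((- X) ^ m * pcompose q (- X))"
      using sq unfolding X s' q' pcompose_mult pow .
    also have "\<dots> = (X * X) ^ m * (q * ((- 1) ^ m * pcompose q (- X)))"
      unfolding power_minus[of X] power_mult_distrib by (simp only: mult_ac)
    finally have "c * ((X * X) ^ Suc k * pcompose s (X * X)) = q * ((- 1) ^ m * pcompose q (- X))"
      by (subst (asm) mult_cancel_left) (simp add: X(3))
    then have "poly (c * ((X * X) ^ Suc k * pcompose s (X * X))) 0 =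
        poly (q * ((- 1) ^ m * pcompose q (- X))) 0" by simp
    then show False using q0 by (simp add: poly_pcompose X_def)
  qed
  then show ?thesis
    unfolding p_def[symmetric] q(1) by (simp add: le_imp_power_dvd dvd_mult2)
qed

text \<open>The columns of \<open>P\<close> are a basis of the whole space that extends a basis of
  \<open>V\<close>; \<open>I\<close> indexes the columns taken from \<open>V\<close>.\<close>

lemma subspace_adapted_matrix:
  fixes V :: "(real^'n) set"
  obtains P :: "real^'n^'n" and I where "det P \<noteq> 0" "card I = dim V" "\<And>i. i \<in> I \<Longrightarrow> column i P \<in> V"
proof -
  obtain A where A: "A \<subseteq> V" "independent A" "card A = dim V"
    using basis_exists[of V] by metis
  obtain B where B: "A \<subseteq> B" "independent B" "span B = UNIV"
    by (rule maximal_independent_subset_extend[OF subset_UNIV A(2)]) auto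
  have finB: "finite B" using B(2) finiteI_independent by blast
  have "card B = CARD('n)"
    using dim_span_eq_card_independent[OF B(2)] B(3) by simp
  then obtain e where e: "bij_betw e (UNIV :: 'n set) B"
    using finite_same_card_bij[of "UNIV :: 'n set" B] finB by auto
  define P where "P = (\<chi> i j. e j $ i)"
  have col: "column j P = e j" for j by (simp add: P_def column_def vec_eq_iff)
  have "columns P = B"
    using e by (auto simp: columns_def col bij_betw_def)
  then have "invertible P"
    unfolding invertible_right_inverse matrix_right_invertible_span_columns using B(3) by (simp add: span_vec_eq)
  then have "det P \<noteq> 0" using invertible_det_nz by blast
  moreover have "bij_betw e (e -` A) A"
    using e B(1) by (auto simp: bij_betw_def inj_on_def)
  then have "card (e -` A) = dim V" using A(3) bij_betw_same_card by metis
  ultimately show ?thesis using that[of P "e -` A"] A(1) col by auto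
qed

lemma map_matrix_of_real_mult:
  "map_matrix complex_of_real (X ** Y) = map_matrix complex_of_real X ** map_matrix complex_of_real Y"
  by (rule map_matrix_mult) simp_all

lemma count_eigenvalues_zero:
  "n \<le> count (eigenvalues A) 0 \<longleftrightarrow> [:0, 1:] ^ n dvd charpoly (map_matrix complex_of_real A)"
  using order_divides[of 0 n "charpoly (map_matrix complex_of_real A)"]
  by (simp add: eigenvalues_def charpoly_nonzero)

lemma count_eigenvalues_square_zero_le:
  "count (eigenvalues (B ** B)) 0 \<le> count (eigenvalues B) 0"
  by (metis count_eigenvalues_zero map_matrix_of_real_mult order_refl power_dvd_charpoly_of_square)

text \<open>Geometric multiplicity is at most algebraic multiplicity. The matrix adapted to the real
  kernel remains invertible over the complex numbers, where the eigenvalues are counted.\<close>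

lemma dim_kernel_le_count_eigenvalues_zero:
  fixes C :: "real^'n^'n"
  shows "dim {x. C *v x = 0} \<le> count (eigenvalues C) 0"
proof -
  let ?h = "map_matrix complex_of_real"
  obtain P :: "real^'n^'n" and I where P: "det P \<noteq> 0" "card I = dim {x. C *v x = 0}"
    "\<And>i. i \<in> I \<Longrightarrow> column i P \<in> {x. C *v x = 0}"
    using subspace_adapted_matrix by metis
  have "(C ** P) $ j $ i = (C *v column i P) $ j" for i j
    by (simp add: matrix_matrix_mult_def matrix_vector_mult_def column_def)
  then have "(C ** P) $ j $ i = 0" if "i \<in> I" for i j
    using P(3)[OF that] by simp
  then have 0: "(?h C ** ?h P) $ j $ i = 0" if "i \<in> I" for i j
    using that by (simp add: map_matrix_of_real_mult[symmetric])
  have "det (?h P) = complex_of_real (det P)" by (rule det_map_matrix) simp_all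
  then have "det (?h P) \<noteq> 0" using P(1) by simp
  from power_dvd_charpoly[of "?h P" I, OF this 0] show ?thesis
    by (simp add: count_eigenvalues_zero P(2))
qed

lemma real_eigenvalue_in_eigenvalues:
  fixes B :: "real^'n^'n"
  assumes "B *v x = c *\<^sub>R x" "x \<noteq> 0"
  shows "complex_of_real c \<in># eigenvalues B"
proof -
  have "(mat c - B) *v x = 0"
    using assms(1)
    by (simp add: matrix_vector_mult_diff_rdistrib)
      (simp add: vec_eq_iff matrix_vector_mult_def mat_def if_distrib[of "\<lambda>x. x * _"] cong: if_cong)
  then have "\<not> invertible (mat c - B)"
    using assms(2) unfolding invertible_left_inverse matrix_left_invertible_ker by blast
  then have "det (mat c - B) = 0" using invertible_det_nz by blast
  moreover have "mat (complex_of_real c) - map_matrix complex_of_real B =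
      map_matrix complex_of_real (mat c - B)"
    by (simp add: vec_eq_iff mat_def)
  ultimately have "poly (charpoly (map_matrix complex_of_real B)) (complex_of_real c) = 0"
    unfolding poly_charpoly by (simp add: det_map_matrix)
  then show ?thesis by (simp add: eigenvalues_def charpoly_nonzero)
qed

text \<open>An orthogonal diagonalisation identifies the negative roots of the characteristic polynomial
  with the negative vectors of an orthonormal basis.\<close>
lemma morse_index_eq_morse_index_on:
  fixes S :: "real^'n^'n"
  assumes sym: "transpose S = S"
  shows "morse_index S = morse_index_on S UNIV" "morse_coindex S = morse_index_on (- S) UNIV"
proof -
  obtain B where B: "pairwise orthogonal B" "\<And>b. b \<in> B \<Longrightarrow> norm b = 1" "span B = UNIV"
    "pairwise (\<lambda>b c. (S *v b) \<bullet> c = 0) B"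
    using symmetric_form_orthonormal_basis[OF sym subspace_UNIV] by metis
  have ind: "independent B" using B(1,2) by (rule orthonormal_independent)
  have fin: "finite B" using ind finiteI_independent by blast
  have "card B = CARD('n)"
    using dim_span_eq_card_independent[OF ind] B(3) by simp
  then obtain e where e: "bij_betw e (UNIV :: 'n set) B"
    using finite_same_card_bij[of "UNIV :: 'n set" B] fin by auto
  have eB: "e i \<in> B" for i using e by (auto simp: bij_betw_def)
  have e_inj: "e i \<noteq> e j" if "i \<noteq> j" for i j using e that by (auto simp: bij_betw_def inj_on_def)
  define P where "P = (\<chi> i j. e j $ i)"
  let ?l = "\<lambda>i. (S *v e i) \<bullet> e i"
  have "(transpose P ** P) $ i $ j = e i \<bullet> e j" for i j
    by (simp add: matrix_matrix_mult_def transpose_def P_def inner_vec_def)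
  moreover have "e i \<bullet> e j = (if i = j then 1 else 0)" for i j
    using B(2)[OF eB[of i]] B(1) eB[of i] eB[of j] e_inj[of i j]
    by (auto simp: norm_eq_1 pairwise_def orthogonal_def)
  ultimately have PP: "transpose P ** P = mat 1" by (simp add: vec_eq_iff mat_def)
  have "(transpose P ** (S ** P)) $ i $ j = e i \<bullet> (S *v e j)" for i j
    by (simp add: matrix_matrix_mult_def matrix_vector_mult_def transpose_def P_def inner_vec_def)
  moreover have "e i \<bullet> (S *v e j) = (if i = j then ?l i else 0)" for i j
    using B(4) eB[of i] eB[of j] e_inj[of i j] by (auto simp: pairwise_def inner_commute)
  ultimately have D: "transpose P ** S ** P = (\<chi> i j. if i = j then ?l i else 0)"
    by (simp add: vec_eq_iff matrix_mul_assoc)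
  have "charpoly S = charpoly (transpose P ** S ** P)" using charpoly_similar[OF PP] by simp
  also have "\<dots> = (\<Prod>i\<in>UNIV. [:- ?l i, 1:])"
    unfolding charpoly_def D by (subst det_diagonal) (simp_all add: mat_def)
  finally have "proots (charpoly S) = (\<Sum>i\<in>UNIV. {#?l i#})"
    by (simp add: proots_prod)
  also have "\<dots> = image_mset ?l (mset_set UNIV)"
    by (simp add: sum_unfold_sum_mset)
  finally have roots: "proots (charpoly S) = image_mset ?l (mset_set UNIV)" .
  have count: "size (filter_mset Q (proots (charpoly S))) = card {b\<in>B. Q ((S *v b) \<bullet> b)}" for Q
  proof -
    have "size (filter_mset Q (proots (charpoly S))) = card {i. Q (?l i)}"
      by (simp add: roots filter_mset_image_mset)
    also have "\<dots> = card {b\<in>B. Q ((S *v b) \<bullet> b)}"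
    proof (rule bij_betw_same_card)
      show "bij_betw e {i. Q (?l i)} {b\<in>B. Q ((S *v b) \<bullet> b)}"
        using e by (auto simp: bij_betw_def inj_on_def)
    qed
    finally show ?thesis .
  qed
  show "morse_index S = morse_index_on S UNIV"
    unfolding morse_index_def count using morse_index_on_span[OF ind B(4)] B(3) by simp
  have "morse_index_on (- S) (span B) = card {b\<in>B. ((- S) *v b) \<bullet> b < 0}"
    using B(4) by (intro morse_index_on_span ind) (simp add: matrix_vector_mult_minus_left)
  then show "morse_coindex S = morse_index_on (- S) UNIV"
    unfolding morse_coindex_def count using B(3) by (simp add: matrix_vector_mult_minus_left)
qed

section \<open>The Hessian of the vortex Hamiltonian\<close>

text \<open>As a linear map, \<open>z\<^sub>i - z\<^sub>j\<close> makes the chain rule immediate,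
  and its adjoint carries planar gradients back to the full space.\<close>

definition separation :: "'n \<times> 'n \<Rightarrow> real^('n::finite \<times> 2) \<Rightarrow> real^2" where
  "separation p z = vortex z (fst p) - vortex z (snd p)"

lemma linear_separation: "linear (separation p)"
  by (rule linearI) (simp_all add: separation_def vortex_def vec_eq_iff algebra_simps)

lemma bounded_linear_separation: "bounded_linear (separation p)"
  using linear_separation linear_conv_bounded_linear by blast

lemma bounded_linear_adjoint_separation: "bounded_linear (adjoint (separation p))"
  using linear_separation adjoint_linear linear_conv_bounded_linear by blast

lemma separation_nonzero:
  "z \<in> config_space \<Longrightarrow> i \<noteq> j \<Longrightarrow> separation (i, j) z \<noteq> 0"
  by (simp add: config_space_def separation_def)

text \<open>Lets the gradient formula be differentiated: it holds in a neighbourhood of each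
  configuration.\<close>

lemma open_config_space: "open (config_space :: (real^('n::finite \<times> 2)) set)"
proof -
  have eq: "(config_space :: (real^('n \<times> 2)) set) = (\<Inter>p\<in>{(i, j). i \<noteq> j}. {z. separation p z \<noteq> 0})"
    by (auto simp: config_space_def separation_def)
  have "open {z :: real^('n \<times> 2). separation p z \<noteq> 0}" for p
    by (intro open_Collect_neq continuous_intros linear_continuous_on bounded_linear_separation)
  then show ?thesis unfolding eq by (intro open_INT ballI) auto
qed

text \<open>This is the gradient of \<open>ln (norm u)\<close>.\<close>

definition sphere_inversion :: "'a::real_inner \<Rightarrow> 'a" where
  "sphere_inversion u = u /\<^sub>R (u \<bullet> u)"

text \<open>For nonzero \<open>u\<close>, the reflection in the hyperplane orthogonal to
  \<open>u\<close>, divided by the squared norm of \<open>u\<close>; hence the Hessian of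
  \<open>ln (norm u)\<close>.\<close>

definition sphere_inversion_deriv :: "'a::real_inner \<Rightarrow> 'a \<Rightarrow> 'a" where
  "sphere_inversion_deriv u v = v /\<^sub>R (u \<bullet> u) - (2 * (u \<bullet> v) / (u \<bullet> u)\<^sup>2) *\<^sub>R u"

lemma has_derivative_ln_norm:
  fixes u :: "'a::real_inner"
  assumes "u \<noteq> 0"
  shows "((\<lambda>x. ln (norm x)) has_derivative (\<lambda>h. h \<bullet> sphere_inversion u)) (at u)"
proof -
  have "((\<lambda>x. ln (norm x)) has_derivative (\<lambda>h. (h \<bullet> sgn u) * (inverse (norm u)))) (at u)"
    using assms by (auto intro!: derivative_eq_intros has_derivative_norm simp: divide_inverse inner_commute)
  then show ?thesis
    by (simp add: sphere_inversion_def sgn_div_norm power2_norm_eq_inner[symmetric] power2_eq_square mult_ac)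
qed

lemma has_derivative_sphere_inversion:
  fixes u :: "'a::real_inner"
  assumes "u \<noteq> 0"
  shows "(sphere_inversion has_derivative sphere_inversion_deriv u) (at u)"
proof -
  have "((\<lambda>x. inverse (x \<bullet> x)) has_derivative
      (\<lambda>h. - (inverse (u \<bullet> u) * (u \<bullet> h + h \<bullet> u) * inverse (u \<bullet> u)))) (at u)"
    using assms by (intro Deriv.has_derivative_inverse has_derivative_inner has_derivative_ident) simp
  from has_derivative_scaleR[OF this has_derivative_ident]
  show ?thesis
    unfolding sphere_inversion_def[abs_def] sphere_inversion_deriv_def[abs_def]
    by (simp add: inner_commute power2_eq_square divide_inverse mult_ac)
qed

lemma sphere_inversion_deriv_self: "sphere_inversion_deriv u u = - sphere_inversion u"
proof (cases "u = 0")
  case False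
  then have "inverse (u \<bullet> u) - 2 * (u \<bullet> u) / (u \<bullet> u)\<^sup>2 = - inverse (u \<bullet> u)"
    by (simp add: power2_eq_square divide_inverse)
  then show ?thesis
    unfolding sphere_inversion_deriv_def sphere_inversion_def
    by (metis scaleR_left_diff_distrib scaleR_minus_left)
qed (simp add: sphere_inversion_deriv_def sphere_inversion_def)

lemma sphere_inversion_deriv_symmetric:
  "sphere_inversion_deriv u v \<bullet> w = v \<bullet> sphere_inversion_deriv u w"
  by (simp add: sphere_inversion_deriv_def inner_simps inner_commute)

lemma J_mult: "(J *v v) $ 1 = v $ 2" "(J *v v) $ 2 = - v $ 1"
  by (simp_all add: J_def matrix_vector_mult_def sum_2)

lemma J_skew: "(J *v v) \<bullet> w = - (v \<bullet> (J *v w))"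
  by (simp add: inner_vec_def sum_2 J_mult)

text \<open>The logarithmic potential is harmonic, so its planar Hessian is symmetric and traceless.\<close>
lemma sphere_inversion_deriv_J:
  "sphere_inversion_deriv u (J *v v) = - (J *v sphere_inversion_deriv u v)"
proof (cases "u = 0")
  case False
  then have r: "u \<bullet> u \<noteq> 0" by simp
  \<comment> \<open>Clearing denominators turns the claim into a polynomial identity in the two
    coordinates.\<close>
  have scaled: "(u \<bullet> u)\<^sup>2 *\<^sub>R sphere_inversion_deriv u w = (u \<bullet> u) *\<^sub>R w - (2 * (u \<bullet> w)) *\<^sub>R u" for w
    using r by (simp add: sphere_inversion_deriv_def scaleR_right_diff_distrib power2_eq_square)
  have "(u \<bullet> u)\<^sup>2 *\<^sub>R sphere_inversion_deriv u (J *v v) =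
      - (J *v ((u \<bullet> u)\<^sup>2 *\<^sub>R sphere_inversion_deriv u v))"
    unfolding scaled by (simp add: vec_eq_iff forall_2 inner_vec_def sum_2 J_mult algebra_simps)
  also have "\<dots> = (u \<bullet> u)\<^sup>2 *\<^sub>R (- (J *v sphere_inversion_deriv u v))"
    by (simp add: matrix_vector_mult_scaleR)
  finally have eq: "(u \<bullet> u)\<^sup>2 *\<^sub>R sphere_inversion_deriv u (J *v v) =
      (u \<bullet> u)\<^sup>2 *\<^sub>R (- (J *v sphere_inversion_deriv u v))" .
  have "(u \<bullet> u)\<^sup>2 \<noteq> 0" using r by simp
  then show ?thesis using eq by (rule scaleR_left_imp_eq)
qed (simp add: sphere_inversion_deriv_def matrix_vector_mult_scaleR)

section \<open>Blockwise action of \<open>K\<close> and of the circulation matrix\<close>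

lemma vortex_K: "vortex (K *v z) i = J *v vortex z i"
proof -
  have "(K *v z) $ (i, a) = (J *v vortex z i) $ a" for a
  proof -
    have "(K *v z) $ (i, a) = (\<Sum>j\<in>UNIV. \<Sum>b\<in>UNIV. mat 1 $ i $ j * J $ a $ b * z $ (j, b))"
      by (simp add: K_def kron_def matrix_vector_mult_def sum.cartesian_product split_def)
    also have "\<dots> = (\<Sum>j\<in>UNIV. if i = j then \<Sum>b\<in>UNIV. J $ a $ b * z $ (j, b) else 0)"
      by (intro sum.cong) (auto simp: mat_def)
    finally show ?thesis by (simp add: matrix_vector_mult_def vortex_def)
  qed
  then show ?thesis by (simp add: vortex_def vec_eq_iff)
qed

lemma vortex_circ_matrix: "vortex (circ_matrix \<Gamma> *v z) i = \<Gamma> i *\<^sub>R vortex z i"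
proof -
  have "(circ_matrix \<Gamma> *v z) $ (i, a) = \<Gamma> i * z $ (i, a)" for a
  proof -
    have "(circ_matrix \<Gamma> *v z) $ (i, a) =
        (\<Sum>j\<in>UNIV. \<Sum>b\<in>UNIV. (if i = j then \<Gamma> i else 0) * mat 1 $ a $ b * z $ (j, b))"
      by (simp add: circ_matrix_def kron_def matrix_vector_mult_def sum.cartesian_product split_def cong: if_cong)
    also have "\<dots> = (\<Sum>j\<in>UNIV. if i = j then \<Sum>b\<in>UNIV. if a = b then \<Gamma> i * z $ (j, b) else 0 else 0)"
      by (intro sum.cong refl) (auto simp: mat_def if_distrib[of "\<lambda>x. x * _"] if_distrib[of "\<lambda>x. _ * x"] cong: if_cong)
    finally show ?thesis by simp
  qed
  then show ?thesis by (simp add: vortex_def vec_eq_iff)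
qed

lemma vortex_eqI: "(\<And>i. vortex x i = vortex y i) \<Longrightarrow> x = y"
  by (auto simp: vortex_def vec_eq_iff)

lemma vortex_uminus: "vortex (- x) i = - vortex x i"
  by (simp add: vortex_def vec_eq_iff)

lemma inner_eq_sum_vortex: "x \<bullet> y = (\<Sum>i\<in>UNIV. vortex x i \<bullet> vortex y i)"
  by (simp add: inner_vec_def vortex_def sum.cartesian_product split_def)

lemma K_skew: "(K *v x) \<bullet> y = - (x \<bullet> (K *v y))"
  by (simp add: inner_eq_sum_vortex vortex_K J_skew sum_negf)

lemma K_square: "K *v (K *v x) = - x"
  by (rule vortex_eqI) (simp add: vortex_K vortex_uminus vec_eq_iff forall_2 J_mult)

lemma separation_K: "separation p (K *v z) = J *v separation p z"
  by (simp add: separation_def vortex_K matrix_vector_mult_diff_distrib)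

text \<open>The adjoint form of \<open>separation_K\<close>: both \<open>J\<close> and
  \<open>K\<close> are skew, so the two signs cancel.\<close>

lemma adjoint_separation_J: "adjoint (separation p) (J *v v) = K *v adjoint (separation p) v"
proof -
  have "x \<bullet> adjoint (separation p) (J *v v) = x \<bullet> (K *v adjoint (separation p) v)" for x
  proof -
    have "x \<bullet> adjoint (separation p) (J *v v) = - ((K *v x) \<bullet> adjoint (separation p) v)"
      by (simp add: adjoint_works linear_separation separation_K J_skew)
    then show ?thesis by (simp add: K_skew)
  qed
  then show ?thesis by (metis vector_eq_ldot)
qed

section \<open>Gradient and Hessian of the Hamiltonian\<close>

definition pairs :: "('n::{finite,linorder} \<times> 'n) set" where
  "pairs = {(i, j). i < j}"

lemma pairs_nonzero: "z \<in> config_space \<Longrightarrow> p \<in> pairs \<Longrightarrow> separation p z \<noteq> 0"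
  using separation_nonzero by (fastforce simp: pairs_def)

lemma grad_hamiltonian:
  fixes \<Gamma> :: "'n::{finite,linorder} \<Rightarrow> real"
  assumes "z \<in> config_space"
  shows "grad (hamiltonian \<Gamma>) z = - (\<Sum>p\<in>pairs. (\<Gamma> (fst p) * \<Gamma> (snd p)) *\<^sub>R
    adjoint (separation p) (sphere_inversion (separation p z)))" (is "_ = ?g")
proof -
  have H: "hamiltonian \<Gamma> = (\<lambda>z. - (\<Sum>p\<in>pairs. \<Gamma> (fst p) * \<Gamma> (snd p) * ln (norm (separation p z))))"
    by (simp add: hamiltonian_def fun_eq_iff pairs_def separation_def split_def)
  have "((\<lambda>z. ln (norm (separation p z))) has_derivative
      (\<lambda>h. separation p h \<bullet> sphere_inversion (separation p z))) (at z)" if "p \<in> pairs" for p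
    using has_derivative_compose[OF bounded_linear_imp_has_derivative[OF bounded_linear_separation]
      has_derivative_ln_norm[OF pairs_nonzero[OF assms that]]] .
  then have "(hamiltonian \<Gamma> has_derivative (\<lambda>h. - (\<Sum>p\<in>pairs. \<Gamma> (fst p) * \<Gamma> (snd p) *
      (separation p h \<bullet> sphere_inversion (separation p z))))) (at z)"
    unfolding H by (intro has_derivative_minus has_derivative_sum has_derivative_mult_right)
  also have "(\<lambda>h. - (\<Sum>p\<in>pairs. \<Gamma> (fst p) * \<Gamma> (snd p) *
      (separation p h \<bullet> sphere_inversion (separation p z)))) = (\<lambda>h. h \<bullet> ?g)"
    by (simp add: fun_eq_iff inner_sum_right adjoint_works linear_separation)
  finally have D: "GDERIV (hamiltonian \<Gamma>) z :> ?g" by (simp add: gderiv_def)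
  show ?thesis
    unfolding grad_def
  proof (rule the_equality)
    show "GDERIV (hamiltonian \<Gamma>) z :> ?g" by (rule D)
    fix D' assume "GDERIV (hamiltonian \<Gamma>) z :> D'"
    then have "(\<lambda>h. h \<bullet> D') = (\<lambda>h. h \<bullet> ?g)"
      using D unfolding gderiv_def by (rule has_derivative_unique)
    then have "h \<bullet> D' = h \<bullet> ?g" for h by (rule fun_cong)
    then show "D' = ?g" using vector_eq_ldot by blast
  qed
qed

lemma hessian_hamiltonian:
  fixes \<Gamma> :: "'n::{finite,linorder} \<Rightarrow> real"
  assumes \<xi>: "\<xi> \<in> config_space"
  shows "hessian (hamiltonian \<Gamma>) \<xi> *v h = - (\<Sum>p\<in>pairs. (\<Gamma> (fst p) * \<Gamma> (snd p)) *\<^sub>R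
    adjoint (separation p) (sphere_inversion_deriv (separation p \<xi>) (separation p h)))"
proof -
  let ?g = "\<lambda>z. - (\<Sum>p\<in>pairs. (\<Gamma> (fst p) * \<Gamma> (snd p)) *\<^sub>R
    adjoint (separation p) (sphere_inversion (separation p z)))"
  let ?D = "\<lambda>h. - (\<Sum>p\<in>pairs. (\<Gamma> (fst p) * \<Gamma> (snd p)) *\<^sub>R
    adjoint (separation p) (sphere_inversion_deriv (separation p \<xi>) (separation p h)))"
  have "((\<lambda>z. adjoint (separation p) (sphere_inversion (separation p z))) has_derivative
      (\<lambda>h. adjoint (separation p) (sphere_inversion_deriv (separation p \<xi>) (separation p h)))) (at \<xi>)"
    if "p \<in> pairs" for p
    using bounded_linear.has_derivative[OF bounded_linear_adjoint_separation
      has_derivative_compose[OF bounded_linear_imp_has_derivative[OF bounded_linear_separation]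
        has_derivative_sphere_inversion[OF pairs_nonzero[OF \<xi> that]]]] .
  then have "(?g has_derivative ?D) (at \<xi>)"
    by (intro has_derivative_minus has_derivative_sum has_derivative_scaleR_right)
  \<comment> \<open>The explicit gradient is known only on configurations, so the derivative is
    transferred along this open set.\<close>
  then have D: "(grad (hamiltonian \<Gamma>) has_derivative ?D) (at \<xi>)"
    by (rule has_derivative_transform_within_open[OF _ open_config_space \<xi>])
      (simp add: grad_hamiltonian)
  then have "(grad (hamiltonian \<Gamma>) has_derivative (\<lambda>h. hessian (hamiltonian \<Gamma>) \<xi> *v h)) (at \<xi>)"
    unfolding hessian_def using jacobian_works differentiableI by blast
  from has_derivative_unique[OF this D] show ?thesis by (rule fun_cong)
qed

lemma hessian_hamiltonian_symmetric:
  assumes "\<xi> \<in> config_space"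
  shows "transpose (hessian (hamiltonian \<Gamma>) \<xi>) = hessian (hamiltonian \<Gamma>) \<xi>"
proof (rule symmetric_matrixI)
  fix x y
  have *: "adjoint (separation p) v \<bullet> w = v \<bullet> separation p w" for p :: "'a \<times> 'a" and v w
    by (metis adjoint_works inner_commute linear_separation)
  show "(hessian (hamiltonian \<Gamma>) \<xi> *v x) \<bullet> y = x \<bullet> (hessian (hamiltonian \<Gamma>) \<xi> *v y)"
    by (simp add: hessian_hamiltonian[OF assms] inner_sum_left inner_sum_right adjoint_works
        linear_separation * sphere_inversion_deriv_symmetric)
qed

text \<open>In each pair's summand \<open>K\<close> passes as \<open>J\<close> through the
  separation and its adjoint; the single sign comes from the traceless planar Hessian in
  between.\<close>

lemma hessian_hamiltonian_K:
  assumes "\<xi> \<in> config_space"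
  shows "hessian (hamiltonian \<Gamma>) \<xi> *v (K *v x) = - (K *v (hessian (hamiltonian \<Gamma>) \<xi> *v x))"
proof -
  have "linear (adjoint (separation p))" for p :: "'a \<times> 'a"
    by (intro adjoint_linear linear_separation)
  then show ?thesis
    by (simp add: hessian_hamiltonian[OF assms] separation_K sphere_inversion_deriv_J linear_neg
        adjoint_separation_J linear_sum[OF matrix_vector_mul_linear] matrix_vector_mult_scaleR
        linear_neg[OF matrix_vector_mul_linear] sum_negf)
qed

text \<open>Euler's relation for the gradient, which is homogeneous of degree \<open>-1\<close>.\<close>
lemma hessian_hamiltonian_self:
  assumes "\<xi> \<in> config_space"
  shows "hessian (hamiltonian \<Gamma>) \<xi> *v \<xi> = - grad (hamiltonian \<Gamma>) \<xi>"
proof -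
  have "linear (adjoint (separation p))" for p :: "'a \<times> 'a"
    by (intro adjoint_linear linear_separation)
  then show ?thesis
    by (simp add: hessian_hamiltonian[OF assms] grad_hamiltonian[OF assms]
        sphere_inversion_deriv_self linear_neg sum_negf)
qed

section \<open>The stability matrix\<close>

text \<open>\<open>T\<close> stands for \<open>M\<inverse> D\<close>, so that \<open>R (T + \<omega>)\<close> is the stability matrix.\<close>
locale stable_pencil =
  fixes D M R T :: "real^'n^'n" and \<omega> :: real and \<xi> :: "real^'n"
  assumes D_sym: "transpose D = D" and M_sym: "transpose M = M"
    and M_inj: "\<And>x. M *v x = 0 \<Longrightarrow> x = 0"
    and R_square: "\<And>x. R *v (R *v x) = - x"
    and R_skew: "\<And>x y. (R *v x) \<bullet> y = - (x \<bullet> (R *v y))"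
    and R_M: "\<And>x. R *v (M *v x) = M *v (R *v x)"
    and D_R: "\<And>x. D *v (R *v x) = - (R *v (D *v x))"
    and M_T: "\<And>x. M *v (T *v x) = D *v x"
    and D_\<xi>: "D *v \<xi> = \<omega> *\<^sub>R (M *v \<xi>)"
    and \<xi>_nz: "\<xi> \<noteq> 0" and \<omega>_nz: "\<omega> \<noteq> 0"
    and stable: "\<And>\<mu>. \<mu> \<in># eigenvalues (R ** (T + \<omega> *\<^sub>R mat 1)) \<Longrightarrow> Re \<mu> = 0"
    and nondegenerate: "count (eigenvalues (R ** (T + \<omega> *\<^sub>R mat 1))) 0 \<le> 2"
begin

definition B where "B = R ** (T + \<omega> *\<^sub>R mat 1)"

section \<open>The generalised kernel of the stability matrix\<close>

lemma M_inner: "(M *v x) \<bullet> y = x \<bullet> (M *v y)"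
  and D_inner: "(D *v x) \<bullet> y = x \<bullet> (D *v y)"
  using inner_matrix_symmetric M_sym D_sym by blast+

lemma M_cancel: "M *v x = M *v y \<Longrightarrow> x = y"
  using M_inj[of "x - y"] by (simp add: matrix_vector_mult_diff_distrib)

lemma T_R: "T *v (R *v x) = - (R *v (T *v x))"
  by (rule M_cancel)
    (simp add: M_T D_R linear_neg[OF matrix_vector_mul_linear] R_M[symmetric])

lemma B_mult: "B *v x = R *v (T *v x) + \<omega> *\<^sub>R (R *v x)"
  by (simp add: B_def matrix_vector_mul_assoc[symmetric] matrix_vector_mult_add_rdistrib
      scaleR_matrix_vector_assoc[symmetric] matrix_vector_right_distrib matrix_vector_mult_scaleR)

text \<open>\<open>T\<close> anticommutes with \<open>R\<close> and \<open>R\<close> squares to -1,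
  so the two mixed terms cancel.\<close>

lemma B_square: "(B ** B) *v x = T *v (T *v x) - \<omega>\<^sup>2 *\<^sub>R x"
  by (simp add: matrix_vector_mul_assoc[symmetric] B_mult matrix_vector_right_distrib
      matrix_vector_mult_scaleR T_R R_square linear_neg[OF matrix_vector_mul_linear]
      power2_eq_square algebra_simps)

lemma T_\<xi>: "T *v \<xi> = \<omega> *\<^sub>R \<xi>"
  by (rule M_cancel) (simp add: M_T D_\<xi> matrix_vector_mult_scaleR)

lemma D_R_\<xi>: "D *v (R *v \<xi>) = - \<omega> *\<^sub>R (M *v (R *v \<xi>))"
  by (simp add: D_R D_\<xi> R_M matrix_vector_mult_scaleR)

definition W where "W = span {\<xi>, R *v \<xi>}"

lemma R_\<xi>_nz: "R *v \<xi> \<noteq> 0"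
  using R_square[of \<xi>] \<xi>_nz by auto

lemma \<xi>_orth_R_\<xi>: "\<xi> \<bullet> (R *v \<xi>) = 0"
  using R_skew[of \<xi> \<xi>] by (simp add: inner_commute)

lemma dim_W: "dim W = 2"
proof -
  have ne: "\<xi> \<noteq> R *v \<xi>" using \<xi>_orth_R_\<xi> \<xi>_nz by (metis inner_eq_zero_iff)
  have "independent {\<xi>, R *v \<xi>}"
    using \<xi>_nz R_\<xi>_nz \<xi>_orth_R_\<xi>
    by (intro pairwise_orthogonal_independent)
      (auto simp: pairwise_def orthogonal_def inner_commute)
  then show ?thesis
    unfolding W_def using dim_span_eq_card_independent ne by fastforce
qed

lemma subspace_kernel: "subspace {x. A *v x = 0}" for A :: "real^'n^'n"
  by (rule linear_subspace_kernel[OF matrix_vector_mul_linear])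

lemma W_kernel: "x \<in> W \<Longrightarrow> (B ** B) *v x = 0"
proof -
  have "W \<subseteq> {x. (B ** B) *v x = 0}"
    unfolding W_def
    by (intro span_minimal subspace_kernel)
      (simp add: B_square T_\<xi> T_R matrix_vector_mult_scaleR power2_eq_square
        linear_neg[OF matrix_vector_mul_linear])
  then show "x \<in> W \<Longrightarrow> (B ** B) *v x = 0" by blast
qed

lemma eq_W:
  assumes "subspace X" "W \<subseteq> X" "dim X \<le> 2"
  shows "X = W"
  using assms dim_W by (metis W_def subspace_dim_equal subspace_span)

text \<open>The kernel already contains \<open>W\<close>, and its dimension is at most the
  multiplicity of 0 for \<open>B\<close>, which is at most \<open>2 = dim W\<close>.\<close>

lemma kernel_B_square: "{x. (B ** B) *v x = 0} = W"
proof (rule eq_W[OF subspace_kernel])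
  show "dim {x. (B ** B) *v x = 0} \<le> 2"
    using dim_kernel_le_count_eigenvalues_zero[of "B ** B"] count_eigenvalues_square_zero_le[of B]
      nondegenerate by (simp add: B_def)
qed (use W_kernel in blast)

text \<open>The same count, passing from \<open>B\<close> to its square twice:
  \<open>B\<^sup>2\<close> has no Jordan chain of length 2 at 0.\<close>

lemma kernel_B_square_square: "{x. ((B ** B) ** (B ** B)) *v x = 0} = W"
proof (rule eq_W[OF subspace_kernel])
  show "dim {x. ((B ** B) ** (B ** B)) *v x = 0} \<le> 2"
    using dim_kernel_le_count_eigenvalues_zero[of "(B ** B) ** (B ** B)"]
      count_eigenvalues_square_zero_le[of B] count_eigenvalues_square_zero_le[of "B ** B"]
      nondegenerate by (simp add: B_def)
  show "W \<subseteq> {x. ((B ** B) ** (B ** B)) *v x = 0}"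
    using W_kernel by (auto simp: matrix_vector_mul_assoc[of "B ** B", symmetric])
qed

text \<open>\<open>M T = D\<close> is symmetric, so \<open>T\<close> is
  \<open>M\<close>-selfadjoint, and so is every real polynomial in \<open>T\<close>.\<close>

lemma M_B_square: "(M *v ((B ** B) *v x)) \<bullet> y = (M *v x) \<bullet> ((B ** B) *v y)"
proof -
  have T: "(M *v (T *v x)) \<bullet> y = (M *v x) \<bullet> (T *v y)" for x y
    by (simp add: M_T M_inner D_inner)
  show ?thesis
    by (simp add: B_square matrix_vector_mult_diff_distrib matrix_vector_mult_scaleR inner_simps T)
qed

definition m where "m = (M *v \<xi>) \<bullet> \<xi>"

text \<open>\<open>R\<close> is skew, squares to -1 and commutes with \<open>M\<close>, so it is an
  isometry of the form of \<open>M\<close> that sends each vector to an \<open>M\<close>-orthogonal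
  one.\<close>

lemma M_\<xi>_R_\<xi>: "(M *v \<xi>) \<bullet> (R *v \<xi>) = 0" "(M *v (R *v \<xi>)) \<bullet> \<xi> = 0"
  and M_R_\<xi>_R_\<xi>: "(M *v (R *v \<xi>)) \<bullet> (R *v \<xi>) = m"
proof -
  have "(M *v \<xi>) \<bullet> (R *v \<xi>) = - ((M *v (R *v \<xi>)) \<bullet> \<xi>)"
    using R_skew[of "M *v \<xi>" \<xi>] by (simp add: R_M)
  moreover have "(M *v (R *v \<xi>)) \<bullet> \<xi> = (M *v \<xi>) \<bullet> (R *v \<xi>)"
    by (simp add: M_inner inner_commute)
  ultimately show "(M *v \<xi>) \<bullet> (R *v \<xi>) = 0" "(M *v (R *v \<xi>)) \<bullet> \<xi> = 0" by simp_all
  show "(M *v (R *v \<xi>)) \<bullet> (R *v \<xi>) = m"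
    by (simp add: R_M[symmetric] R_skew R_square m_def)
qed

text \<open>If \<open>\<xi>\<close> were \<open>M\<close>-isotropic, then \<open>M \<xi>\<close> would be orthogonal to \<open>W = ker B\<^sup>2\<close>, hence \<open>\<xi>\<close>
  would lie in the image of the \<open>M\<close>-selfadjoint map \<open>B\<^sup>2\<close>, making the generalised
  kernel of \<open>B\<close> too large.\<close>
lemma m_nz: "m \<noteq> 0"
proof
  assume m0: "m = 0"
  let ?N = "range (\<lambda>x. M *v ((B ** B) *v x))"
  have "linear (\<lambda>x. M *v ((B ** B) *v x))"
    using linear_compose[OF matrix_vector_mul_linear[of "B ** B"] matrix_vector_mul_linear[of M]]
    by (simp add: o_def)
  then have N: "subspace ?N" using linear_subspace_image subspace_UNIV by blast
  \<comment> \<open>Split \<open>M \<xi>\<close> into \<open>y\<close> in the range and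
    \<open>w\<close> orthogonal to it. Selfadjointness puts \<open>w\<close> into
    \<open>ker B\<^sup>2 = W\<close>, to which \<open>M \<xi>\<close> is orthogonal because
    \<open>m = 0\<close>; hence \<open>w\<close> is orthogonal to itself.\<close>
  have "M *v \<xi> \<in> ?N"
  proof -
    obtain y w where yw: "y \<in> span ?N" "\<And>v. v \<in> span ?N \<Longrightarrow> orthogonal w v" "M *v \<xi> = y + w"
      using orthogonal_subspace_decomp_exists[of ?N "M *v \<xi>"] by metis
    have "(M *v ((B ** B) *v w)) \<bullet> x = 0" for x
    proof -
      have "(M *v ((B ** B) *v w)) \<bullet> x = w \<bullet> (M *v ((B ** B) *v x))"
        by (metis M_B_square M_inner inner_commute)
      also have "\<dots> = 0"
        using yw(2)[OF span_base] by (auto simp: orthogonal_def)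
      finally show ?thesis .
    qed
    then have "M *v ((B ** B) *v w) = 0" by (metis inner_eq_zero_iff)
    then have "w \<in> W" using M_inj kernel_B_square by blast
    then have "w \<bullet> (M *v \<xi>) = 0"
      unfolding W_def
    proof (induction rule: span_induct_alt)
      case (step c x y)
      then have "x \<bullet> (M *v \<xi>) = 0"
        using M_\<xi>_R_\<xi> m0 by (auto simp: m_def inner_commute)
      then show ?case using step by (simp add: inner_simps)
    qed simp
    moreover have "w \<bullet> y = 0" using yw(1,2) by (simp add: orthogonal_def)
    ultimately have "w = 0" using yw(3) by (simp add: inner_simps)
    then show ?thesis using yw(1,3) N by (simp add: span_eq_iff[THEN iffD2])
  qed
  then obtain y where "M *v \<xi> = M *v ((B ** B) *v y)" by auto
  then have y: "\<xi> = (B ** B) *v y" by (rule M_cancel)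
  have "\<xi> \<in> W" unfolding W_def by (simp add: span_base)
  \<comment> \<open>A preimage \<open>y\<close> of \<open>\<xi>\<close> under
    \<open>B\<^sup>2\<close> lies in the kernel of \<open>B\<^sup>4\<close>, which is no larger than
    that of \<open>B\<^sup>2\<close>.\<close>
  then have "((B ** B) ** (B ** B)) *v y = 0"
    using W_kernel y by (simp add: matrix_vector_mul_assoc[of "B ** B", symmetric])
  then have "(B ** B) *v y = 0" using kernel_B_square_square kernel_B_square by blast
  then show False using y \<xi>_nz by simp
qed

section \<open>The complement of \<open>W\<close> and the index along the pencil\<close>

definition U where "U = {w. \<forall>v\<in>W. w \<bullet> (M *v v) = 0}"

lemma U_iff: "w \<in> U \<longleftrightarrow> w \<bullet> (M *v \<xi>) = 0 \<and> w \<bullet> (M *v (R *v \<xi>)) = 0"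
proof
  assume "w \<in> U"
  then show "w \<bullet> (M *v \<xi>) = 0 \<and> w \<bullet> (M *v (R *v \<xi>)) = 0"
    by (simp add: U_def W_def span_base)
next
  assume w: "w \<bullet> (M *v \<xi>) = 0 \<and> w \<bullet> (M *v (R *v \<xi>)) = 0"
  have "w \<bullet> (M *v v) = 0" if "v \<in> W" for v
    using that unfolding W_def
    by (induction rule: span_induct_alt)
      (use w in \<open>auto simp: matrix_vector_right_distrib matrix_vector_mult_scaleR inner_simps\<close>)
  then show "w \<in> U" by (simp add: U_def)
qed

lemma subspace_U: "subspace U"
  by (simp add: subspace_def U_iff inner_simps)

text \<open>Subtracts the \<open>M\<close>-orthogonal projection onto \<open>W\<close>. Both
  spanning vectors have \<open>M\<close>-square \<open>m\<close>, nonzero by \<open>m_nz\<close>,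
  which explains the denominators.\<close>

lemma decompose:
  obtains a b u where "u \<in> U" "x = a *\<^sub>R \<xi> + (b *\<^sub>R (R *v \<xi>) + u)"
proof -
  define a where "a = (x \<bullet> (M *v \<xi>)) / m"
  define b where "b = (x \<bullet> (M *v (R *v \<xi>))) / m"
  have "x - a *\<^sub>R \<xi> - b *\<^sub>R (R *v \<xi>) \<in> U"
    using M_\<xi>_R_\<xi> M_R_\<xi>_R_\<xi> m_def m_nz
    by (simp add: U_iff inner_simps inner_commute a_def b_def)
  then show ?thesis
    using that[of "x - a *\<^sub>R \<xi> - b *\<^sub>R (R *v \<xi>)" a b] by simp
qed

lemma U_W_trivial: "x \<in> U \<Longrightarrow> x \<in> W \<Longrightarrow> x = 0"
proof -
  assume x: "x \<in> U" "x \<in> W"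
  have "x \<in> span (insert \<xi> {R *v \<xi>})" using x(2) by (simp add: W_def)
  then obtain a where "x - a *\<^sub>R \<xi> \<in> span (insert (R *v \<xi>) {})" using span_breakdown_eq by blast
  then obtain b where "x - a *\<^sub>R \<xi> - b *\<^sub>R (R *v \<xi>) \<in> span {}" using span_breakdown_eq by blast
  then have x_eq: "x = a *\<^sub>R \<xi> + b *\<^sub>R (R *v \<xi>)" by (simp add: algebra_simps)
  have "a * m = 0" "b * m = 0"
    using x(1) M_\<xi>_R_\<xi> M_R_\<xi>_R_\<xi> unfolding U_iff x_eq
    by (simp_all add: inner_simps inner_commute m_def)
  then show "x = 0" using m_nz x_eq by simp
qed

lemma no_real_eigenvalue:
  assumes "B *v x = c *\<^sub>R x" "c \<noteq> 0"
  shows "x = 0"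
  using real_eigenvalue_in_eigenvalues[OF assms(1)] stable[of "complex_of_real c"] assms(2)
  by (auto simp: B_def)

text \<open>Factor \<open>B\<^sup>2 - c = (B - k) (B + k)\<close> with \<open>k = sqrt c\<close>: an
  eigenvector would produce one of \<open>B\<close> for \<open>k\<close> or \<open>- k\<close>, and
  stability allows no nonzero real eigenvalue.\<close>

lemma no_positive_eigenvalue_square:
  assumes "(B ** B) *v x = c *\<^sub>R x" "c > 0"
  shows "x = 0"
proof -
  define k where "k = sqrt c"
  have k: "k * k = c" "k \<noteq> 0" using assms(2) by (simp_all add: k_def)
  have "B *v (B *v x + k *\<^sub>R x) = k *\<^sub>R (B *v x + k *\<^sub>R x)"
    using assms(1) k(1)
    by (simp add: matrix_vector_right_distrib matrix_vector_mult_scaleR matrix_vector_mul_assoc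
        scaleR_right_distrib)
  then have "B *v x + k *\<^sub>R x = 0" using no_real_eigenvalue k(2) by blast
  then have "B *v x = (- k) *\<^sub>R x" by (simp add: eq_neg_iff_add_eq_0)
  then show ?thesis using no_real_eigenvalue[of x "- k"] k(2) by simp
qed

lemma pencil_nondegenerate:
  assumes t: "t \<in> {0..1}" and x: "x \<in> U"
    and orth: "\<And>y. y \<in> U \<Longrightarrow> ((\<omega> *\<^sub>R M + t *\<^sub>R D) *v x) \<bullet> y = 0"
  shows "x = 0"
proof -
  let ?G = "\<omega> *\<^sub>R M + t *\<^sub>R D"
  have G: "?G *v y = \<omega> *\<^sub>R (M *v y) + t *\<^sub>R (D *v y)" for y
    by (simp add: matrix_vector_mult_add_rdistrib scaleR_matrix_vector_assoc[symmetric])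
  \<comment> \<open>On \<open>\<xi>\<close> and \<open>R \<xi>\<close> the matrix \<open>D\<close>
    acts as a multiple of \<open>M\<close>, so \<open>U\<close> is also orthogonal to
    \<open>W\<close> for the pencil. Orthogonality to \<open>U\<close> therefore upgrades to
    orthogonality to everything.\<close>
  have "(?G *v x) \<bullet> \<xi> = 0" "(?G *v x) \<bullet> (R *v \<xi>) = 0"
    using x by (simp_all add: G inner_simps M_inner D_inner D_\<xi> D_R_\<xi> U_iff)
  then have "(?G *v x) \<bullet> y = 0" for y
    using orth by (rule_tac decompose[of y]) (simp add: inner_simps)
  then have "?G *v x = 0" by (metis inner_eq_zero_iff)
  then have "M *v (\<omega> *\<^sub>R x + t *\<^sub>R (T *v x)) = 0"
    by (simp add: G matrix_vector_right_distrib matrix_vector_mult_scaleR M_T)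
  then have 0: "\<omega> *\<^sub>R x + t *\<^sub>R (T *v x) = 0" by (rule M_inj)
  show ?thesis
  proof (cases "t = 0")
    case True
    then show ?thesis using 0 \<omega>_nz by simp
  next
    case False
    define s where "s = - \<omega> / t"
    have "t *\<^sub>R (T *v x) = t *\<^sub>R (s *\<^sub>R x)"
      using 0 False by (simp add: s_def eq_neg_iff_add_eq_0 add.commute)
    then have Tx: "T *v x = s *\<^sub>R x" using False scaleR_left_imp_eq by blast
    have sq: "(B ** B) *v x = (s\<^sup>2 - \<omega>\<^sup>2) *\<^sub>R x"
      by (simp add: B_square Tx matrix_vector_mult_scaleR scaleR_left_diff_distrib power2_eq_square)
    have "\<omega>\<^sup>2 * t\<^sup>2 \<le> \<omega>\<^sup>2 * 1"
      using t by (intro mult_left_mono) (auto simp: power_le_one)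
    then have "\<omega>\<^sup>2 \<le> s\<^sup>2"
      using False by (simp add: s_def power_divide pos_le_divide_eq)
    then consider "s\<^sup>2 - \<omega>\<^sup>2 = 0" | "s\<^sup>2 - \<omega>\<^sup>2 > 0" by linarith
    then show ?thesis
    proof cases
      \<comment> \<open>The borderline case, as at \<open>t = 1\<close>, needs the generalised
        kernel: \<open>x\<close> lies in both \<open>W\<close> and \<open>U\<close>.\<close>
      case 1
      then have "(B ** B) *v x = 0" using sq by simp
      then show ?thesis using kernel_B_square U_W_trivial[OF x] by blast
    qed (use no_positive_eigenvalue_square[OF sq] in blast)
  qed
qed

lemma morse_index_on_U:
  "morse_index_on (D + \<omega> *\<^sub>R M) U = morse_index_on (\<omega> *\<^sub>R M) U"
proof -
  have "morse_index_on (\<omega> *\<^sub>R M) U = morse_index_on (\<omega> *\<^sub>R M + D) U"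
    using pencil_nondegenerate
    by (intro morse_index_on_homotopy subspace_U D_sym) (auto simp: transpose_scalar M_sym)
  then show ?thesis by (simp add: add.commute)
qed

text \<open>A \<open>Q\<close>-diagonal basis of \<open>U\<close> is extended by
  \<open>\<xi>\<close> and \<open>R \<xi>\<close>. There \<open>Q\<close> acts as a multiple of
  \<open>M\<close>, so these vectors are \<open>Q\<close>-orthogonal to \<open>U\<close> and to each
  other, with values \<open>a m\<close> and \<open>b m\<close>.\<close>

lemma morse_index_split:
  assumes sym: "transpose Q = Q"
    and \<xi>: "Q *v \<xi> = a *\<^sub>R (M *v \<xi>)" and R_\<xi>: "Q *v (R *v \<xi>) = b *\<^sub>R (M *v (R *v \<xi>))"
  shows "morse_index_on Q UNIV =
    morse_index_on Q U + (if a * m < 0 then 1 else 0) + (if b * m < 0 then 1 else 0)"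
proof -
  obtain C where C: "C \<subseteq> U" "pairwise orthogonal C" "\<And>b. b \<in> C \<Longrightarrow> norm b = 1" "span C = U"
    "pairwise (\<lambda>b c. (Q *v b) \<bullet> c = 0) C"
    using symmetric_form_orthonormal_basis[OF sym subspace_U] by metis
  have indC: "independent C" using C(2,3) by (rule orthonormal_independent)
  have finC: "finite C" using indC finiteI_independent by blast
  have R_notin: "R *v \<xi> \<notin> span C"
    using M_R_\<xi>_R_\<xi> m_nz by (simp add: C(4) U_iff inner_commute)
  have \<xi>_notin: "\<xi> \<notin> span (insert (R *v \<xi>) C)"
  proof
    assume "\<xi> \<in> span (insert (R *v \<xi>) C)"
    then obtain k where "\<xi> - k *\<^sub>R (R *v \<xi>) \<in> U" using span_breakdown_eq C(4) by blast
    then have "m = 0" using M_\<xi>_R_\<xi> by (simp add: U_iff inner_simps inner_commute m_def)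
    then show False using m_nz by simp
  qed
  let ?B = "insert \<xi> (insert (R *v \<xi>) C)"
  have ind: "independent ?B"
    using indC R_notin \<xi>_notin by (intro independent_insertI)
  have span: "span ?B = UNIV"
  proof -
    have "x \<in> span ?B" for x
    proof -
      obtain a b u where u: "u \<in> U" "x = a *\<^sub>R \<xi> + (b *\<^sub>R (R *v \<xi>) + u)" by (rule decompose)
      have "u \<in> span ?B" using u(1) C(4) span_mono[of C ?B] by blast
      then show ?thesis unfolding u(2) by (intro span_add span_scale) (simp_all add: span_base)
    qed
    then show ?thesis by blast
  qed
  have orth: "pairwise (\<lambda>b c. (Q *v b) \<bullet> c = 0) ?B"
  proof -
    have "(Q *v \<xi>) \<bullet> c = 0 \<and> (Q *v c) \<bullet> \<xi> = 0 \<and>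
        (Q *v (R *v \<xi>)) \<bullet> c = 0 \<and> (Q *v c) \<bullet> (R *v \<xi>) = 0" if "c \<in> C" for c
    proof -
      have "c \<in> U" using that C(1) by blast
      then have "(Q *v \<xi>) \<bullet> c = 0" "(Q *v (R *v \<xi>)) \<bullet> c = 0"
        by (simp_all add: \<xi> R_\<xi> U_iff inner_commute)
      then show ?thesis using inner_matrix_symmetric[OF sym] by (metis inner_commute)
    qed
    moreover have "(Q *v \<xi>) \<bullet> (R *v \<xi>) = 0" "(Q *v (R *v \<xi>)) \<bullet> \<xi> = 0"
      by (simp_all add: \<xi> R_\<xi> M_\<xi>_R_\<xi>)
    ultimately show ?thesis using C(5) by (auto simp: pairwise_insert)
  qed
  let ?n = "\<lambda>b. (Q *v b) \<bullet> b < 0"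
  have "\<xi> \<notin> insert (R *v \<xi>) C" "R *v \<xi> \<notin> C"
    using \<xi>_notin R_notin span_base by blast+
  moreover have "{b\<in>?B. ?n b} = (if ?n \<xi> then {\<xi>} else {}) \<union> ((if ?n (R *v \<xi>) then {R *v \<xi>} else {}) \<union> {b\<in>C. ?n b})"
    by auto
  ultimately have "card {b\<in>?B. ?n b} =
      card {b\<in>C. ?n b} + (if ?n \<xi> then 1 else 0) + (if ?n (R *v \<xi>) then 1 else 0)"
    using finC by auto
  moreover have "(Q *v \<xi>) \<bullet> \<xi> = a * m" "(Q *v (R *v \<xi>)) \<bullet> (R *v \<xi>) = b * m"
    by (simp_all add: \<xi> R_\<xi> M_R_\<xi>_R_\<xi> m_def)
  ultimately show ?thesis
    using morse_index_on_span[OF ind orth] morse_index_on_span[OF indC C(5)]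
    by (simp add: span C(4))
qed

text \<open>The indices on \<open>U\<close> agree, so only \<open>W\<close> matters. There the
  pencil has multipliers \<open>2 \<omega>\<close> and \<open>0\<close>, whereas
  \<open>\<omega> M\<close> has \<open>\<omega>\<close> twice; if \<open>\<omega> m < 0\<close>,
  this gives one negative direction against two.\<close>

lemma morse_index_pencil:
  "morse_index (D + \<omega> *\<^sub>R M) + (if \<omega> * m < 0 then 1 else 0) = morse_index_on (\<omega> *\<^sub>R M) UNIV"
proof -
  have sym: "transpose (D + \<omega> *\<^sub>R M) = D + \<omega> *\<^sub>R M"
    using D_sym M_sym by (simp add: transpose_def vec_eq_iff)
  have "morse_index_on (D + \<omega> *\<^sub>R M) UNIV =
      morse_index_on (D + \<omega> *\<^sub>R M) U + (if 2 * \<omega> * m < 0 then 1 else 0) + (if 0 * m < 0 then 1 else 0)"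
    by (rule morse_index_split[OF sym])
      (simp_all add: matrix_vector_mult_add_rdistrib scaleR_matrix_vector_assoc[symmetric] D_\<xi> D_R_\<xi>
        scaleR_left_distrib[symmetric])
  moreover have "morse_index_on (\<omega> *\<^sub>R M) UNIV =
      morse_index_on (\<omega> *\<^sub>R M) U + (if \<omega> * m < 0 then 1 else 0) + (if \<omega> * m < 0 then 1 else 0)"
    by (rule morse_index_split)
      (simp_all add: transpose_scalar M_sym scaleR_matrix_vector_assoc[symmetric])
  moreover have "2 * \<omega> * m < 0 \<longleftrightarrow> \<omega> * m < 0" by (simp add: mult.assoc)
  ultimately show ?thesis
    by (simp add: morse_index_eq_morse_index_on(1)[OF sym] morse_index_on_U)
qed

end

section \<open>Application to relative equilibria\<close>

lemma stable_pencil_relative_equilibrium: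
  fixes \<Gamma> :: "'n::{finite,linorder} \<Rightarrow> real" and \<xi> :: "real^('n \<times> 2)"
  assumes N: "CARD('n) \<ge> 2" and \<Gamma>: "\<And>i. \<Gamma> i \<noteq> 0" and \<omega>: "\<omega> \<noteq> 0"
    and cc: "central_configuration \<Gamma> \<omega> \<xi>"
    and nd: "nondegenerate \<Gamma> \<omega> (relative_equilibrium \<omega> \<xi>)"
    and st: "spectrally_stable \<Gamma> \<omega> (relative_equilibrium \<omega> \<xi>)"
  shows "stable_pencil (hessian (hamiltonian \<Gamma>) \<xi>) (circ_matrix \<Gamma>) K
    (matrix_inv (circ_matrix \<Gamma>) ** hessian (hamiltonian \<Gamma>) \<xi>) \<omega> \<xi>"
proof
  let ?D = "hessian (hamiltonian \<Gamma>) \<xi>" and ?M = "circ_matrix \<Gamma> :: real^('n \<times> 2)^('n \<times> 2)"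
  have conf: "\<xi> \<in> config_space" and eq: "grad (hamiltonian \<Gamma>) \<xi> + \<omega> *\<^sub>R (?M *v \<xi>) = 0"
    using cc by (auto simp: central_configuration_def)
  show "transpose ?D = ?D" by (rule hessian_hamiltonian_symmetric[OF conf])
  show "transpose ?M = ?M"
    by (rule symmetric_matrixI) (simp add: inner_eq_sum_vortex vortex_circ_matrix)
  show inj: "x = 0" if "?M *v x = 0" for x
  proof (rule vortex_eqI)
    fix i
    have "\<Gamma> i *\<^sub>R vortex x i = vortex 0 i" using that by (metis vortex_circ_matrix)
    then show "vortex x i = vortex 0 i" using \<Gamma>[of i] by (simp add: vortex_def vec_eq_iff)
  qed
  show "K *v (K *v x) = - x" for x :: "real^('n \<times> 2)" by (rule K_square)
  show "(K *v x) \<bullet> y = - (x \<bullet> (K *v y))" for x y :: "real^('n \<times> 2)" by (rule K_skew)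
  show "K *v (?M *v x) = ?M *v (K *v x)" for x
    by (rule vortex_eqI) (simp add: vortex_K vortex_circ_matrix matrix_vector_mult_scaleR)
  show "?D *v (K *v x) = - (K *v (?D *v x))" for x by (rule hessian_hamiltonian_K[OF conf])
  show "?M *v ((matrix_inv ?M ** ?D) *v x) = ?D *v x" for x
  proof -
    have "invertible ?M"
      unfolding invertible_left_inverse matrix_left_invertible_ker using inj by blast
    then have "?M ** matrix_inv ?M = mat 1"
      unfolding invertible_def matrix_inv_def by (metis (mono_tags, lifting) someI_ex)
    then show ?thesis by (simp add: matrix_vector_mul_assoc matrix_mul_assoc)
  qed
  show "?D *v \<xi> = \<omega> *\<^sub>R (?M *v \<xi>)"
    unfolding hessian_hamiltonian_self[OF conf] using eq by (simp add: neg_eq_iff_add_eq_0)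
  show "\<xi> \<noteq> 0"
  \<comment> \<open>At the origin all vortices coincide, which is impossible for at least two of
    them.\<close>
  proof
    assume 0: "\<xi> = 0"
    obtain i j :: 'n where "i \<noteq> j"
      using N by (metis card_2_iff' ex_card subset_UNIV)
    then show False using conf 0 by (auto simp: config_space_def vortex_def)
  qed
  show "\<omega> \<noteq> 0" by (rule \<omega>)
  define E where "E = eigenvalues (K ** (matrix_inv ?M ** ?D + \<omega> *\<^sub>R mat 1))"
  define X where "X = {#0, 0, \<i> * complex_of_real \<omega>, - \<i> * of_real \<omega>#}"
  have nt: "nontrivial_eigenvalues \<Gamma> \<omega> (relative_equilibrium \<omega> \<xi> 0) = E - X"
    by (simp add: nontrivial_eigenvalues_def stability_matrix_def relative_equilibrium_0 E_def X_def)
  show "Re \<mu> = 0" if "\<mu> \<in># eigenvalues (K ** (matrix_inv ?M ** ?D + \<omega> *\<^sub>R mat 1))" for \<mu>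
  proof (rule ccontr)
    assume re: "Re \<mu> \<noteq> 0"
    \<comment> \<open>The removed eigenvalues all have real part 0, so \<open>\<mu>\<close> survives
      the removal.\<close>
    then have "\<mu> \<notin># X" by (auto simp: X_def)
    then have "\<mu> \<in># E - X" using that by (simp add: E_def in_diff_count not_in_iff)
    then show False using st re unfolding spectrally_stable_def nt by blast
  qed
  \<comment> \<open>Multiset difference truncates at zero, so this bounds the multiplicity of 0 from
    above. Since \<open>\<omega> \<noteq> 0\<close>, exactly two copies of 0 are removed.\<close>
  have "0 \<notin># E - X" using nd unfolding nondegenerate_def nt by blast
  then have "count E 0 \<le> count X 0" by (simp add: not_in_iff)
  also have "count X 0 = 2" using \<omega> by (simp add: X_def)
  finally show "count (eigenvalues (K ** (matrix_inv ?M ** ?D + \<omega> *\<^sub>R mat 1))) 0 \<le> 2"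
    by (simp add: E_def)
qed

theorem theorem2:
  fixes \<Gamma> :: "'n::{finite,linorder} \<Rightarrow> real"
    and \<omega> :: real
    and \<xi> :: "real^('n \<times> 2)"
    and z :: "real \<Rightarrow> real^('n \<times> 2)"
    and W :: "(real^('n \<times> 2)) set"
  assumes "CARD('n) \<ge> 2"
    and "\<And>i. \<Gamma> i \<noteq> 0"
    and "(\<Sum>i\<in>UNIV. \<Gamma> i) \<noteq> 0"
    and "\<omega> \<noteq> 0"
    and "central_configuration \<Gamma> \<omega> \<xi>"
    and "z = relative_equilibrium \<omega> \<xi>"
    and "nondegenerate \<Gamma> \<omega> z"
    and "spectrally_stable \<Gamma> \<omega> z"
    and "W = span {\<xi>, K *v \<xi>}"
  shows "(\<omega> > 0 \<longrightarrow>
            ((circ_matrix \<Gamma> *v \<xi>) \<bullet> \<xi> > 0 \<longrightarrow>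
               int (morse_index (A_hat \<Gamma> \<omega> \<xi>)) = int (morse_index (circ_matrix \<Gamma>))) \<and>
            ((circ_matrix \<Gamma> *v \<xi>) \<bullet> \<xi> < 0 \<longrightarrow>
               int (morse_index (A_hat \<Gamma> \<omega> \<xi>)) = int (morse_index (circ_matrix \<Gamma>)) - 1)) \<and>
         (\<omega> < 0 \<longrightarrow>
            ((circ_matrix \<Gamma> *v \<xi>) \<bullet> \<xi> > 0 \<longrightarrow>
               int (morse_index (A_hat \<Gamma> \<omega> \<xi>)) = int (morse_coindex (circ_matrix \<Gamma>)) - 1) \<and>
            ((circ_matrix \<Gamma> *v \<xi>) \<bullet> \<xi> < 0 \<longrightarrow>
               int (morse_index (A_hat \<Gamma> \<omega> \<xi>)) = int (morse_coindex (circ_matrix \<Gamma>)))) \<and>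
         (\<omega> > 0 \<longrightarrow>
            morse_index_on (A_hat \<Gamma> \<omega> \<xi>) (circ_orth \<Gamma> W) =
            morse_index_on (circ_matrix \<Gamma>) (circ_orth \<Gamma> W)) \<and>
         (\<omega> < 0 \<longrightarrow>
            morse_index_on (A_hat \<Gamma> \<omega> \<xi>) (circ_orth \<Gamma> W) =
            morse_coindex_on (circ_matrix \<Gamma>) (circ_orth \<Gamma> W))"
proof -
  interpret P: stable_pencil "hessian (hamiltonian \<Gamma>) \<xi>" "circ_matrix \<Gamma>" K
    "matrix_inv (circ_matrix \<Gamma>) ** hessian (hamiltonian \<Gamma>) \<xi>" \<omega> \<xi>
    using assms by (intro stable_pencil_relative_equilibrium) auto
  have U: "circ_orth \<Gamma> W = P.U"
    by (simp add: circ_orth_def P.U_def P.W_def assms(9))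
  note index = P.morse_index_pencil[folded A_hat_def, unfolded P.m_def]
    and on_U = P.morse_index_on_U[folded A_hat_def U]
  show ?thesis
  \<comment> \<open>A positive factor \<open>\<omega>\<close> keeps the index of \<open>M\<close>, a
    negative one turns it into the coindex. The sign of \<open>\<omega> m\<close> decides whether 1
    is subtracted.\<close>
  proof (cases "\<omega> > 0")
    case True
    then show ?thesis
      using index on_U
      by (auto simp: morse_index_eq_morse_index_on[OF P.M_sym] morse_index_on_scaleR(1) mult_less_0_iff)
  next
    case False
    then have "\<omega> < 0" using assms(4) by simp
    then show ?thesis
      using index on_U
      by (auto simp: morse_index_eq_morse_index_on[OF P.M_sym] morse_index_on_scaleR(2)
          morse_coindex_on_eq mult_less_0_iff)
  qed
qed

end
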